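(* Let $p$ be an odd prime and let $G$ be a finite $p$-group of nilpotency class $c\neq 1$. Let $n=\lceil \log_{p-1} c\rceil$. Then $\exp(G\wedge G)$ divides $\exp(G)^n$. In particular, $\exp(M(G))$ divides $\exp(G)^n$.
   Context: Conventions: ${}^g h = ghg^{-1}$, $[g,h]=ghg^{-1}h^{-1}$. The nonabelian tensor square $G\otimes G$ is generated by symbols $g\otimes h$ subject to $gg'\otimes h=({}^g g'\otimes {}^g h)(g\otimes h)$ and $g\otimes hh'=(g\otimes h)({}^h g\otimes {}^h h')$; the exterior square $G\wedge G$ is its quotient by the subgroup generated by all $x\otimes x$. $M(G)$ is the kernel of $G\wedge G\to[G,G]$, $g\wedge h\mapsto[g,h]$, isomorphic to $H_2(G,\mathbb{Z})$. *)

theory Defs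
  imports "HOL-Algebra.Algebra" Complex_Main
begin

definition gconj :: "('a, 'b) monoid_scheme \<Rightarrow> 'a \<Rightarrow> 'a \<Rightarrow> 'a" where
  "gconj G g h = g \<otimes>\<^bsub>G\<^esub> h \<otimes>\<^bsub>G\<^esub> inv\<^bsub>G\<^esub> g"

definition gcomm :: "('a, 'b) monoid_scheme \<Rightarrow> 'a \<Rightarrow> 'a \<Rightarrow> 'a" where
  "gcomm G g h = g \<otimes>\<^bsub>G\<^esub> h \<otimes>\<^bsub>G\<^esub> inv\<^bsub>G\<^esub> g \<otimes>\<^bsub>G\<^esub> inv\<^bsub>G\<^esub> h"

text \<open>Lower central series: lcs G 0 = gamma_1 = G, lcs G (i+1) = [lcs G i, G].\<close>
fun lcs :: "('a, 'b) monoid_scheme \<Rightarrow> nat \<Rightarrow> 'a set" where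
  "lcs G 0 = carrier G"
| "lcs G (Suc i) = generate G {gcomm G x y | x y. x \<in> lcs G i \<and> y \<in> carrier G}"

definition nilpotency_class :: "('a, 'b) monoid_scheme \<Rightarrow> nat \<Rightarrow> bool" where
  "nilpotency_class G c \<longleftrightarrow> lcs G c = {\<one>\<^bsub>G\<^esub>} \<and> (\<forall>d<c. lcs G d \<noteq> {\<one>\<^bsub>G\<^esub>})"

text \<open>Exponent: the nonnegative generator of the ideal of annihilating exponents
  (0 if the exponent is infinite).\<close>
definition group_exponent :: "('a, 'b) monoid_scheme \<Rightarrow> nat" where
  "group_exponent G = Gcd {n. \<forall>x\<in>carrier G. x [^]\<^bsub>G\<^esub> n = \<one>\<^bsub>G\<^esub>}"

definition p_group :: "nat \<Rightarrow> ('a, 'b) monoid_scheme \<Rightarrow> bool" where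
  "p_group p G \<longleftrightarrow> finite (carrier G) \<and> (\<exists>k. order G = p ^ k)"

text \<open>A word is a list of letters (x, True) = x and (x, False) = x^-1.\<close>
type_synonym 'x word = "('x \<times> bool) list"

inductive pres_eq :: "'x set \<Rightarrow> ('x word \<times> 'x word) set \<Rightarrow> 'x word \<Rightarrow> 'x word \<Rightarrow> bool"
  for S Rs where
  refl: "pres_eq S Rs w w"
| sym: "pres_eq S Rs u v \<Longrightarrow> pres_eq S Rs v u"
| trans: "pres_eq S Rs u v \<Longrightarrow> pres_eq S Rs v w \<Longrightarrow> pres_eq S Rs u w"
| cancel: "x \<in> S \<Longrightarrow> pres_eq S Rs [(x, b), (x, \<not> b)] []"
| rel: "(u, v) \<in> Rs \<Longrightarrow> pres_eq S Rs u v"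
| cong: "pres_eq S Rs u v \<Longrightarrow> pres_eq S Rs (a @ u @ c) (a @ v @ c)"

definition pres_class :: "'x set \<Rightarrow> ('x word \<times> 'x word) set \<Rightarrow> 'x word \<Rightarrow> 'x word set" where
  "pres_class S Rs w = {v. pres_eq S Rs w v}"

definition presented_group :: "'x set \<Rightarrow> ('x word \<times> 'x word) set \<Rightarrow> ('x word set) monoid" where
  "presented_group S Rs =
     \<lparr> carrier = {pres_class S Rs w | w. \<forall>l\<in>set w. fst l \<in> S},
       monoid.mult = (\<lambda>A B. \<Union>{pres_class S Rs (a @ b) | a b. a \<in> A \<and> b \<in> B}),
       monoid.one = pres_class S Rs [] \<rparr>"

text \<open>Letter (g,h) stands for the generator g \<wedge> h.\<close>
definition ext_relations :: "('a, 'b) monoid_scheme \<Rightarrow> (('a \<times> 'a) word \<times> ('a \<times> 'a) word) set" where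
  "ext_relations G =
     {([((g \<otimes>\<^bsub>G\<^esub> g', h), True)],
       [((gconj G g g', gconj G g h), True), ((g, h), True)])
        | g g' h. g \<in> carrier G \<and> g' \<in> carrier G \<and> h \<in> carrier G}
   \<union> {([((g, h \<otimes>\<^bsub>G\<^esub> h'), True)],
       [((g, h), True), ((gconj G h g, gconj G h h'), True)])
        | g h h'. g \<in> carrier G \<and> h \<in> carrier G \<and> h' \<in> carrier G}
   \<union> {([((x, x), True)], []) | x. x \<in> carrier G}"

definition ext_square :: "('a, 'b) monoid_scheme \<Rightarrow> (('a \<times> 'a) word set) monoid" where
  "ext_square G = presented_group (carrier G \<times> carrier G) (ext_relations G)"

fun wedge_eval :: "('a, 'b) monoid_scheme \<Rightarrow> ('a \<times> 'a) word \<Rightarrow> 'a" where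
  "wedge_eval G [] = \<one>\<^bsub>G\<^esub>"
| "wedge_eval G (((g, h), b) # w) =
     (if b then gcomm G g h else inv\<^bsub>G\<^esub> (gcomm G g h)) \<otimes>\<^bsub>G\<^esub> wedge_eval G w"

definition wedge_comm :: "('a, 'b) monoid_scheme \<Rightarrow> ('a \<times> 'a) word set \<Rightarrow> 'a" where
  "wedge_comm G A = wedge_eval G (SOME w. w \<in> A)"

definition schur_mult :: "('a, 'b) monoid_scheme \<Rightarrow> (('a \<times> 'a) word set) monoid" where
  "schur_mult G = (ext_square G)
     \<lparr> carrier := {A \<in> carrier (ext_square G). wedge_comm G A = \<one>\<^bsub>G\<^esub>} \<rparr>"

end

theory Submission
  imports Defs
begin

text \<open>The key case concerns a group with a filtration \<open>F\<close> satisfying \<open>[F i, F j] \<subseteq> F (i + j)\<close> and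
  \<open>F p = 1\<close>, and a power \<open>q\<close> of \<open>p\<close>: the elements of \<open>F 1\<close> of order dividing \<open>q\<close> are closed under
  products, as in a regular \<open>p\<close>-group. By induction on the length of the filtration one may assume that
  \<open>F 2\<close> has exponent \<open>q\<close>; then \<open>(xy)^n y^-n x^-n\<close> is a polynomial sequence, a product of factors
  \<open>d^(n choose i)\<close> with \<open>d \<in> F i\<close> and \<open>2 \<le> i < p\<close>, so it is trivial at \<open>n = q\<close>.

  The exterior square \<open>T\<close> carries an action of \<open>G\<close>. Let \<open>V n\<close> be generated by the wedges with first
  entry in the \<open>n\<close>-th term of the lower central series (counted from 0). In the semidirect product of
  \<open>T\<close> and \<open>G\<close>, the wedge of \<open>v\<close> and \<open>u\<close> is a product of two elements of order dividing
  \<open>q = exp G\<close>, which lie in the filtration obtained by sampling \<open>V n \<times> lcs G n\<close> in steps of \<open>r\<close>.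
  Hence \<open>q\<close>-th powers take \<open>V (r - 1)\<close> into \<open>V (p r - 1)\<close>, and \<open>q^n\<close>-th powers take \<open>T\<close> into
  \<open>V (p^n - 1)\<close>, which is trivial once \<open>c < p^n\<close>.\<close>

section \<open>Filtrations and polynomial sequences\<close>

text \<open>\<open>F 0\<close> may be a proper subgroup, so a chain inside a subgroup is again a
  filtration of the ambient group. This permits inductions that pass to subgroups without changing
  \<open>G\<close>.\<close>

definition filtration :: "('a, 'b) monoid_scheme \<Rightarrow> (nat \<Rightarrow> 'a set) \<Rightarrow> bool" where
  "filtration G F \<longleftrightarrow> (\<forall>i. subgroup (F i) G) \<and> (\<forall>i. F (Suc i) \<subseteq> F i) \<and>
     (\<forall>i j. \<forall>x\<in>F i. \<forall>y\<in>F j. gcomm G x y \<in> F (i + j))"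

context group
begin

lemma inv_mult_cancel:
  assumes "x \<in> carrier G" "y \<in> carrier G"
  shows "inv x \<otimes> (x \<otimes> y) = y" "x \<otimes> (inv x \<otimes> y) = y"
  using assms by (simp_all add: m_assoc[symmetric])

lemmas word_simps = m_assoc inv_mult_group inv_mult_cancel gcomm_def gconj_def

lemma gcomm_closed [simp, intro]:
  "\<lbrakk>x \<in> carrier G; y \<in> carrier G\<rbrakk> \<Longrightarrow> gcomm G x y \<in> carrier G"
  by (simp add: gcomm_def)

lemma gconj_closed [simp, intro]:
  "\<lbrakk>x \<in> carrier G; y \<in> carrier G\<rbrakk> \<Longrightarrow> gconj G x y \<in> carrier G"
  by (simp add: gconj_def)

lemma inv_gcomm:
  "\<lbrakk>x \<in> carrier G; y \<in> carrier G\<rbrakk> \<Longrightarrow> inv (gcomm G x y) = gcomm G y x"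
  by (simp add: word_simps)

lemma gconj_eq_gcomm_mult:
  "\<lbrakk>x \<in> carrier G; y \<in> carrier G\<rbrakk> \<Longrightarrow> gconj G x y = gcomm G x y \<otimes> y"
  by (simp add: word_simps)

lemma gcomm_mult_left:
  "\<lbrakk>x \<in> carrier G; y \<in> carrier G; z \<in> carrier G\<rbrakk>
    \<Longrightarrow> gcomm G (x \<otimes> y) z = gconj G x (gcomm G y z) \<otimes> gcomm G x z"
  by (simp add: word_simps)

lemma gcomm_mult_right:
  "\<lbrakk>x \<in> carrier G; y \<in> carrier G; z \<in> carrier G\<rbrakk>
    \<Longrightarrow> gcomm G x (y \<otimes> z) = gcomm G x y \<otimes> gconj G y (gcomm G x z)"
  by (simp add: word_simps)

lemma gcomm_inv_left:
  "\<lbrakk>x \<in> carrier G; y \<in> carrier G\<rbrakk>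
    \<Longrightarrow> gcomm G (inv x) y = gconj G (inv x) (inv (gcomm G x y))"
  by (simp add: word_simps)

lemma gconj_hom: "x \<in> carrier G \<Longrightarrow> gconj G x \<in> hom G G"
  by (auto simp: hom_def word_simps)

lemma gconj_pow:
  assumes "x \<in> carrier G" "y \<in> carrier G"
  shows "gconj G x y [^] (n::nat) = gconj G x (y [^] n)"
  using assms by (induction n) (simp_all add: word_simps)

text \<open>For fixed \<open>b\<close>, \<open>gcomm_mult_left\<close> turns the commutator of a
  product into a product of commutators, one of them conjugated. Hence it suffices that the group
  generated by \<open>A\<close> normalises \<open>M\<close>.\<close>

lemma gcomm_generate_left:
  assumes M: "subgroup M G" and A: "A \<subseteq> carrier G" and b: "b \<in> carrier G"
    and nrm: "\<And>g m. \<lbrakk>g \<in> generate G A; m \<in> M\<rbrakk> \<Longrightarrow> gconj G g m \<in> M"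
    and ab: "\<And>a. a \<in> A \<Longrightarrow> gcomm G a b \<in> M"
    and a: "a \<in> generate G A"
  shows "gcomm G a b \<in> M"
  using a
proof (induction a rule: generate.induct)
  case one
  then show ?case using b subgroup.one_closed[OF M] by (simp add: gcomm_def)
next
  case (incl h)
  then show ?case using ab by blast
next
  case (inv h)
  then have "h \<in> carrier G" using A by blast
  then show ?case
    using nrm[OF generate.inv[OF inv]] subgroup.m_inv_closed[OF M ab[OF inv]] b
    by (simp add: gcomm_inv_left)
next
  case (eng h1 h2)
  then have "h1 \<in> carrier G" "h2 \<in> carrier G" using generate_in_carrier[OF A] by auto
  then show ?case
    using nrm[OF eng(1) eng(4)] eng(3) subgroup.m_closed[OF M] b by (simp add: gcomm_mult_left)
qed

lemma gcomm_generate: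
  assumes M: "subgroup M G" and A: "A \<subseteq> carrier G" and B: "B \<subseteq> carrier G"
    and nrm: "\<And>g m. \<lbrakk>g \<in> generate G A \<union> generate G B; m \<in> M\<rbrakk> \<Longrightarrow> gconj G g m \<in> M"
    and ab: "\<And>a b. \<lbrakk>a \<in> A; b \<in> B\<rbrakk> \<Longrightarrow> gcomm G a b \<in> M"
    and a: "a \<in> generate G A" and b: "b \<in> generate G B"
  shows "gcomm G a b \<in> M"
proof -
  have swap: "gcomm G y x \<in> M" if "gcomm G x y \<in> M" "x \<in> carrier G" "y \<in> carrier G" for x y
    using subgroup.m_inv_closed[OF M that(1)] that by (simp add: inv_gcomm)
  have *: "gcomm G a b' \<in> M" if "b' \<in> B" for b'
    using gcomm_generate_left[OF M A _ _ _ a, of b'] that B nrm ab by auto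
  have "gcomm G b a \<in> M"
    using gcomm_generate_left[OF M B _ _ _ b, of a] * swap nrm generate_in_carrier[OF A a] B
    by blast
  then show ?thesis
    using swap generate_in_carrier[OF A a] generate_in_carrier[OF B b] by blast
qed

end

locale filtered_group = group G for G (structure) +
  fixes F :: "nat \<Rightarrow> 'a set"
  assumes filtration: "filtration G F"
begin

lemma F_subgroup: "subgroup (F i) G"
  using filtration unfolding filtration_def by blast

lemma F_Suc: "F (Suc i) \<subseteq> F i"
  using filtration unfolding filtration_def by blast

lemma F_gcomm: "\<lbrakk>x \<in> F i; y \<in> F j\<rbrakk> \<Longrightarrow> gcomm G x y \<in> F (i + j)"
  using filtration unfolding filtration_def by blast

lemma F_mono: "i \<le> j \<Longrightarrow> F j \<subseteq> F i"
  by (rule lift_Suc_antimono_le[of F, OF F_Suc])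

lemma F_carrier: "x \<in> F i \<Longrightarrow> x \<in> carrier G"
  by (rule subgroup.mem_carrier[OF F_subgroup])

lemma F_one: "\<one> \<in> F i"
  by (rule subgroup.one_closed[OF F_subgroup])

lemma F_mult: "\<lbrakk>x \<in> F i; y \<in> F i\<rbrakk> \<Longrightarrow> x \<otimes> y \<in> F i"
  by (rule subgroup.m_closed[OF F_subgroup])

lemma F_inv: "x \<in> F i \<Longrightarrow> inv x \<in> F i"
  by (rule subgroup.m_inv_closed[OF F_subgroup])

lemma F_conj: "\<lbrakk>x \<in> F j; y \<in> F i\<rbrakk> \<Longrightarrow> gconj G x y \<in> F i"
  using F_mult[of "gcomm G x y" i y] F_gcomm[of x j y i] F_mono[of i "j + i"]
  by (metis gconj_eq_gcomm_mult F_carrier le_add2 subsetD)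

lemma F_pow: "x \<in> F i \<Longrightarrow> x [^] (n::nat) \<in> F i"
  by (induction n) (auto intro: F_one F_mult)

text \<open>Commutation is well defined on the graded pieces of the filtration: the quotient factors
  exactly into conjugates of \<open>gcomm G a (h \<otimes> b)\<close> and
  \<open>gcomm G g b\<close>, each of which lies one step deeper.\<close>

lemma gcomm_perturb:
  assumes g: "g \<in> F i" and a: "a \<in> F (Suc i)" and h: "h \<in> F j" and b: "b \<in> F (Suc j)"
  shows "inv (gcomm G g h) \<otimes> gcomm G (g \<otimes> a) (h \<otimes> b) \<in> F (Suc (i + j))"
proof -
  note car = assms[THEN F_carrier]
  have ah: "gcomm G a h \<in> F (Suc (i + j))" using F_gcomm[OF a h] by simp
  have gb: "gcomm G g b \<in> F (Suc (i + j))" using F_gcomm[OF g b] by simp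
  have "gcomm G a b \<in> F (Suc (i + j))" using F_gcomm[OF a b] F_Suc by auto
  then have "gcomm G a (h \<otimes> b) \<in> F (Suc (i + j))"
    using ah F_mult F_conj[OF h] car by (simp add: gcomm_mult_right)
  then have m: "gconj G g (gcomm G a (h \<otimes> b)) \<in> F (Suc (i + j))"
    by (rule F_conj[OF g])
  have m': "gconj G h (gcomm G g b) \<in> F (Suc (i + j))"
    using F_conj[OF h gb] .
  have c: "inv (gcomm G g h) \<in> F (i + j)"
    using F_inv F_gcomm[OF g h] by blast
  have "inv (gcomm G g h) \<otimes> gcomm G (g \<otimes> a) (h \<otimes> b)
      = gconj G (inv (gcomm G g h)) (gconj G g (gcomm G a (h \<otimes> b))) \<otimes> gconj G h (gcomm G g b)"
    using car by (simp add: word_simps)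
  then show ?thesis
    using F_mult[OF F_conj[OF c m] m'] by simp
qed

text \<open>The abstract core of the Lazard-Leibman theorem. When \<open>\<sigma>\<close> is the
  shift of sequences, the condition says that the difference sequence lies one step deeper.\<close>

lemma derived_filtration:
  assumes \<sigma>: "\<sigma> \<in> hom G G"
  shows "filtration G (\<lambda>i. {g \<in> F i. inv g \<otimes> \<sigma> g \<in> F (Suc i)})"
    (is "filtration G ?E")
proof -
  interpret \<sigma>: group_hom G G \<sigma> using \<sigma> by unfold_locales
  have sub: "subgroup (?E i) G" for i
  proof (rule subgroupI)
    show "?E i \<subseteq> carrier G" using F_carrier by blast
    show "?E i \<noteq> {}" using F_one by (auto intro: exI[of _ \<one>])
  next
    fix g assume "g \<in> ?E i"
    then have g: "g \<in> F i" "inv g \<otimes> \<sigma> g \<in> F (Suc i)" by auto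
    have "inv (inv g) \<otimes> \<sigma> (inv g) = gconj G g (inv (inv g \<otimes> \<sigma> g))"
      using F_carrier[OF g(1)] by (simp add: word_simps)
    then show "inv g \<in> ?E i"
      using F_conj[OF g(1) F_inv[OF g(2)]] F_inv[OF g(1)] by simp
  next
    fix g h assume "g \<in> ?E i" "h \<in> ?E i"
    then have g: "g \<in> F i" "inv g \<otimes> \<sigma> g \<in> F (Suc i)"
      and h: "h \<in> F i" "inv h \<otimes> \<sigma> h \<in> F (Suc i)" by auto
    have "inv (g \<otimes> h) \<otimes> \<sigma> (g \<otimes> h)
        = gconj G (inv h) (inv g \<otimes> \<sigma> g) \<otimes> (inv h \<otimes> \<sigma> h)"
      using F_carrier[OF g(1)] F_carrier[OF h(1)] by (simp add: word_simps)
    then show "g \<otimes> h \<in> ?E i"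
      using F_mult[OF F_conj[OF F_inv[OF h(1)] g(2)] h(2)] F_mult[OF g(1) h(1)] by simp
  qed
  have comm: "gcomm G g h \<in> ?E (i + j)" if "g \<in> ?E i" "h \<in> ?E j" for g h i j
  proof -
    have g: "g \<in> F i" "inv g \<otimes> \<sigma> g \<in> F (Suc i)"
      and h: "h \<in> F j" "inv h \<otimes> \<sigma> h \<in> F (Suc j)" using that by auto
    note car = F_carrier[OF g(1)] F_carrier[OF h(1)]
    \<comment> \<open>Each \<open>\<sigma> g\<close> is \<open>g\<close> times its displacement, so
      \<open>\<sigma>\<close> changes the commutator by a perturbation of both entries.\<close>
    have "\<sigma> (gcomm G g h) = gcomm G (g \<otimes> (inv g \<otimes> \<sigma> g)) (h \<otimes> (inv h \<otimes> \<sigma> h))"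
      using car by (simp add: word_simps)
    then have "inv (gcomm G g h) \<otimes> \<sigma> (gcomm G g h) \<in> F (Suc (i + j))"
      using gcomm_perturb[OF g h] by metis
    then show ?thesis using F_gcomm[OF g(1) h(1)] by blast
  qed
  show ?thesis
    unfolding filtration_def
  proof (intro conjI allI ballI)
    show "subgroup (?E i) G" for i by (rule sub)
    show "?E (Suc i) \<subseteq> ?E i" for i using F_Suc by blast
    show "gcomm G g h \<in> ?E (i + j)" if "g \<in> ?E i" "h \<in> ?E j" for i j g h
      using that by (rule comm)
  qed
qed

end

section \<open>Polynomial sequences in a filtered group\<close>

definition sequence_group :: "('a, 'b) monoid_scheme \<Rightarrow> (nat \<Rightarrow> 'a) monoid" where
  "sequence_group G = \<lparr>carrier = {f. \<forall>n. f n \<in> carrier G},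
     monoid.mult = (\<lambda>f g n. f n \<otimes>\<^bsub>G\<^esub> g n), one = (\<lambda>n. \<one>\<^bsub>G\<^esub>)\<rparr>"

lemma sequence_group_simps [simp]:
  "f \<in> carrier (sequence_group G) \<longleftrightarrow> (\<forall>n. f n \<in> carrier G)"
  "f \<otimes>\<^bsub>sequence_group G\<^esub> g = (\<lambda>n. f n \<otimes>\<^bsub>G\<^esub> g n)"
  "\<one>\<^bsub>sequence_group G\<^esub> = (\<lambda>n. \<one>\<^bsub>G\<^esub>)"
  by (simp_all add: sequence_group_def)

context group
begin

lemma group_sequence_group: "group (sequence_group G)"
proof (rule groupI)
  fix f assume "f \<in> carrier (sequence_group G)"
  then show "\<exists>g\<in>carrier (sequence_group G). g \<otimes>\<^bsub>sequence_group G\<^esub> f = \<one>\<^bsub>sequence_group G\<^esub>"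
    by (intro bexI[of _ "\<lambda>n. inv (f n)"]) auto
qed (auto simp: m_assoc)

lemma sequence_group_inv [simp]:
  assumes "\<And>n. f n \<in> carrier G"
  shows "inv\<^bsub>sequence_group G\<^esub> f = (\<lambda>n. inv (f n))"
  by (rule group.inv_equality[OF group_sequence_group]) (use assms in auto)

end

context filtered_group
begin

text \<open>Closing under finitely many differences at a time, rather than under all of them at once,
  keeps every stage a filtration by subgroups.\<close>

fun poly_seq :: "nat \<Rightarrow> nat \<Rightarrow> (nat \<Rightarrow> 'a) set" where
  "poly_seq 0 i = {f. \<forall>n. f n \<in> F i}"
| "poly_seq (Suc k) i = {f \<in> poly_seq k i. (\<lambda>n. inv (f n) \<otimes> f (Suc n)) \<in> poly_seq k (Suc i)}"

lemma poly_seq_value: "f \<in> poly_seq k i \<Longrightarrow> f n \<in> F i"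
  by (induction k) auto

text \<open>Stage 0 is the pointwise filtration, and each further stage is
  \<open>derived_filtration\<close> for the shift. In particular polynomial sequences are closed
  under pointwise products.\<close>

lemma filtration_poly_seq: "filtration (sequence_group G) (poly_seq k)"
proof (induction k)
  case 0
  interpret S: group "sequence_group G" by (rule group_sequence_group)
  have "subgroup (poly_seq 0 i) (sequence_group G)" for i
  proof (rule S.subgroupI)
    show "poly_seq 0 i \<subseteq> carrier (sequence_group G)" using F_carrier by fastforce
    show "poly_seq 0 i \<noteq> {}" using F_one by (auto intro: exI[of _ "\<lambda>n. \<one>"])
    fix f g assume f: "f \<in> poly_seq 0 i"
    then have "f n \<in> carrier G" for n using poly_seq_value F_carrier by blast
    then show "inv\<^bsub>sequence_group G\<^esub> f \<in> poly_seq 0 i" using f F_inv by simp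
    show "f \<otimes>\<^bsub>sequence_group G\<^esub> g \<in> poly_seq 0 i" if "g \<in> poly_seq 0 i"
      using f that F_mult by simp
  qed
  moreover have "gcomm (sequence_group G) f g = (\<lambda>n. gcomm G (f n) (g n))"
    if "f \<in> poly_seq 0 i" "g \<in> poly_seq 0 j" for f g i j
  proof -
    have "\<And>n. f n \<in> carrier G" "\<And>n. g n \<in> carrier G"
      using that poly_seq_value F_carrier by blast+
    then show ?thesis by (simp add: gcomm_def)
  qed
  moreover have "poly_seq 0 (Suc i) \<subseteq> poly_seq 0 i" for i using F_Suc by auto
  ultimately show ?case
    unfolding filtration_def using F_gcomm by simp
next
  case (Suc k)
  interpret S: filtered_group "sequence_group G" "poly_seq k"
    by (intro filtered_group.intro group_sequence_group filtered_group_axioms.intro Suc)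
  have "(\<lambda>f n. f (Suc n)) \<in> hom (sequence_group G) (sequence_group G)"
    by (auto simp: hom_def)
  from S.derived_filtration[OF this]
  have "filtration (sequence_group G) (\<lambda>i. {f \<in> poly_seq k i.
     inv\<^bsub>sequence_group G\<^esub> f \<otimes>\<^bsub>sequence_group G\<^esub> (\<lambda>n. f (Suc n)) \<in> poly_seq k (Suc i)})" .
  also have "(\<lambda>i. {f \<in> poly_seq k i.
     inv\<^bsub>sequence_group G\<^esub> f \<otimes>\<^bsub>sequence_group G\<^esub> (\<lambda>n. f (Suc n)) \<in> poly_seq k (Suc i)})
     = poly_seq (Suc k)"
  proof -
    have "inv\<^bsub>sequence_group G\<^esub> f = (\<lambda>n. inv (f n))" if "f \<in> poly_seq k i" for f i
      using poly_seq_value[OF that, THEN F_carrier] by (rule sequence_group_inv)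
    then show ?thesis by (intro ext) (auto cong: conj_cong)
  qed
  finally show ?case .
qed

lemma poly_seq_mult:
  "\<lbrakk>f \<in> poly_seq k i; g \<in> poly_seq k i\<rbrakk> \<Longrightarrow> (\<lambda>n. f n \<otimes> g n) \<in> poly_seq k i"
  using filtration_poly_seq[of k] subgroup.m_closed[of "poly_seq k i" "sequence_group G" f g]
  by (simp add: filtration_def)

text \<open>By Pascal's rule, taking differences lowers the binomial index by one while the required
  depth rises by one, so the sum \<open>j + i\<close> that governs membership of \<open>a\<close> is
  unchanged.\<close>

lemma poly_seq_choose:
  "a \<in> F (j + i) \<Longrightarrow> (\<lambda>n. a [^] (n choose i)) \<in> poly_seq k j"
proof (induction k arbitrary: a i j)
  case 0
  then show ?case using F_mono[of j "j + i"] F_pow by auto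
next
  case (Suc k)
  have a: "a \<in> carrier G" using Suc.prems F_carrier by blast
  have "(\<lambda>n. inv (a [^] (n choose i)) \<otimes> a [^] (Suc n choose i)) \<in> poly_seq k (Suc j)"
  proof (cases i)
    case 0
    \<comment> \<open>A constant sequence has trivial differences; they are read as powers of
      \<open>\<one>\<close> to fit the induction hypothesis.\<close>
    have "\<one> \<in> F (Suc j + 0)" using F_one by simp
    from Suc.IH[OF this] show ?thesis using 0 a by simp
  next
    case (Suc i')
    have "a \<in> F (Suc j + i')" using Suc.prems Suc by simp
    from Suc.IH[OF this] show ?thesis
      using a Suc by (simp add: nat_pow_mult[symmetric] add.commute[of "_ choose i'"] inv_mult_cancel)
  qed
  then show ?case using Suc.IH[OF Suc.prems] by simp
qed

text \<open>If \<open>f\<close> is trivial before \<open>m > 0\<close>, then \<open>f m\<close> is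
  the difference at \<open>m - 1\<close>, and the difference sequence is trivial before that. Each
  differencing gains one step of depth; \<open>m \<le> k\<close> provides enough of them.\<close>

lemma poly_seq_first_value:
  "\<lbrakk>f \<in> poly_seq k i; m \<le> k; \<And>l. l < m \<Longrightarrow> f l = \<one>\<rbrakk> \<Longrightarrow> f m \<in> F (i + m)"
proof (induction m arbitrary: f i k)
  case 0
  then show ?case using poly_seq_value by auto
next
  case (Suc m)
  obtain k' where k: "k = Suc k'" using Suc.prems(2) by (cases k) auto
  have "(\<lambda>n. inv (f n) \<otimes> f (Suc n)) m \<in> F (Suc i + m)"
    by (rule Suc.IH[of _ k']) (use Suc.prems k in auto)
  then show ?case
    using Suc.prems(3)[of m] poly_seq_value[OF Suc.prems(1), THEN F_carrier] by simp
qed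

text \<open>A Taylor expansion: the factors \<open>f m [^] (n choose m)\<close> are removed one at a
  time, each removal pushing the first nontrivial value further out. At \<open>q\<close> a removed
  factor is trivial, because \<open>m < p\<close> makes \<open>q\<close> divide the binomial
  coefficient and \<open>2 \<le> m\<close> puts \<open>f m\<close> into \<open>F 2\<close>.\<close>

lemma poly_seq_trivial_at:
  assumes dv: "\<And>i. \<lbrakk>0 < i; i < p\<rbrakk> \<Longrightarrow> q dvd (q choose i)"
    and triv: "F p = {\<one>}" and tors: "\<And>a. a \<in> F 2 \<Longrightarrow> a [^] q = \<one>"
    and m: "2 \<le> m" and f: "\<And>k. f \<in> poly_seq k 0" and f1: "\<And>l. l < m \<Longrightarrow> f l = \<one>"
  shows "f q = \<one>"
  using m f f1
proof (induction "p - m" arbitrary: m f)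
  case 0
  \<comment> \<open>Here \<open>p \<le> m\<close>: a first nontrivial value would lie in
    \<open>F n\<close> for some \<open>n \<ge> p\<close>, which is trivial.\<close>
  have "f n = \<one>" for n
  proof (induction n rule: less_induct)
    case (less n)
    show ?case
    proof (cases "n < m")
      case False
      then have "f n \<in> F n" using poly_seq_first_value[OF 0(3)[of n], of n] less by simp
      then show ?thesis using F_mono[of p n] False 0 triv by auto
    qed (use 0 in auto)
  qed
  then show ?case .
next
  case (Suc d)
  have fm: "f m \<in> F m" using poly_seq_first_value[OF Suc(4)[of m], of m] Suc.prems by simp
  have fc: "f n \<in> carrier G" for n using poly_seq_value[OF Suc(4)] F_carrier by blast
  \<comment> \<open>The binomial coefficient is 1 at \<open>n = m\<close> and 0 below, so
    \<open>h\<close> is trivial at \<open>m\<close> too and agrees with \<open>f\<close> before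
    it.\<close>
  define h where "h n = f n \<otimes> inv (f m) [^] (n choose m)" for n
  have "h \<in> poly_seq k 0" for k
    unfolding h_def using F_inv[OF fm] by (intro poly_seq_mult Suc.prems poly_seq_choose) simp
  moreover have "h l = \<one>" if "l < Suc m" for l
    using that Suc.prems(3)[of l] fc by (cases "l = m") (auto simp: h_def binomial_eq_0)
  ultimately have "h q = \<one>"
    using Suc.hyps(1)[of "Suc m" h] Suc.hyps(2) Suc.prems(1) by auto
  moreover have "inv (f m) [^] (q choose m) = \<one>"
  proof -
    have "q dvd (q choose m)" using dv Suc by simp
    then obtain r where r: "q choose m = q * r" by blast
    have "inv (f m) [^] q = \<one>"
      using tors F_inv[OF fm] F_mono[OF Suc.prems(1)] by blast
    then show ?thesis using fc by (simp add: r nat_pow_pow[symmetric])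
  qed
  ultimately show ?case using fc by (simp add: h_def)
qed

section \<open>Products of elements of order dividing q in short filtrations\<close>

lemma mult_torsion_of_torsion_F2:
  assumes dv: "\<And>i. \<lbrakk>0 < i; i < p\<rbrakk> \<Longrightarrow> q dvd (q choose i)"
    and triv: "F p = {\<one>}" and tors: "\<And>a. a \<in> F 2 \<Longrightarrow> a [^] q = \<one>"
    and x: "x \<in> F 1" "x [^] q = \<one>" and y: "y \<in> F 1" "y [^] q = \<one>"
  shows "(x \<otimes> y) [^] q = \<one>"
proof -
  note car = F_carrier[OF x(1)] F_carrier[OF y(1)]
  \<comment> \<open>The values at 0 and 1 are trivial, so the expansion starts at
    \<open>m = 2\<close>; at \<open>q\<close> only \<open>(x \<otimes> y) [^] q\<close>
    remains.\<close>
  define f where "f n = (x \<otimes> y) [^] n \<otimes> (inv y [^] n \<otimes> inv x [^] n)" for n :: nat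
  have P: "(\<lambda>n. a [^] n) \<in> poly_seq k 0" if "a \<in> F 1" for a k
    using poly_seq_choose[of a 0 1 k] that by simp
  have "f \<in> poly_seq k 0" for k
    unfolding f_def by (intro poly_seq_mult P F_mult F_inv x y)
  moreover have "f l = \<one>" if "l < 2" for l
  proof -
    have "l = 0 \<or> l = 1" using that by auto
    then show ?thesis using car by (auto simp: f_def word_simps)
  qed
  ultimately have "f q = \<one>"
    using poly_seq_trivial_at[OF dv triv tors, of 2 f] by simp
  then show ?thesis using car x y by (simp add: f_def nat_pow_inv)
qed

text \<open>Passing to \<open>H\<close> shortens the filtration by one step. As \<open>x\<close>
  commutes with itself, commutators of elements of \<open>H\<close> lie in \<open>F 3\<close> and
  not merely in \<open>F 2\<close>, so every term from index 2 on can be replaced by its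
  successor.\<close>

lemma cyclic_extension_filtration:
  assumes x: "x \<in> F 1"
  defines "H \<equiv> generate G (insert x (F 2))"
  shows "filtration G (\<lambda>i. if i < 2 then H else F (Suc i))" (is "filtration G ?E")
proof -
  have gen: "insert x (F 2) \<subseteq> F 1" using x F_mono[of 1 2] by auto
  then have car: "insert x (F 2) \<subseteq> carrier G" using F_carrier by blast
  have H1: "H \<subseteq> F 1" unfolding H_def by (rule generate_subgroup_incl[OF gen F_subgroup])
  have F2H: "F 2 \<subseteq> H" unfolding H_def by (auto intro: generate.incl)
  have HH: "gcomm G a b \<in> F 3" if "a \<in> H" "b \<in> H" for a b
  proof (rule gcomm_generate[OF F_subgroup car car])
    fix g m assume "g \<in> generate G (insert x (F 2)) \<union> generate G (insert x (F 2))" "m \<in> F 3"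
    then show "gconj G g m \<in> F 3" using F_conj[of g 1 m 3] H1 unfolding H_def by auto
  next
    fix a b assume ab: "a \<in> insert x (F 2)" "b \<in> insert x (F 2)"
    show "gcomm G a b \<in> F 3"
    proof (cases "a = x \<and> b = x")
      case True
      then show ?thesis using F_one F_carrier[OF x] by (simp add: word_simps)
    next
      case False
      then consider "a \<in> F 1" "b \<in> F 2" | "a \<in> F 2" "b \<in> F 1" using ab gen by blast
      then show ?thesis
        using F_gcomm[of a 1 b 2] F_gcomm[of a 2 b 1] by cases (auto simp: numeral_3_eq_3)
    qed
  qed (use that H_def in auto)
  have "gcomm G a b \<in> ?E (i + j)" if a: "a \<in> ?E i" and b: "b \<in> ?E j" for a b i j
  proof (cases "i < 2 \<and> j < 2")
    case True
    then have "gcomm G a b \<in> F 3" using HH a b by simp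
    then show ?thesis
      using F_mono[of "Suc (i + j)" 3] F_mono[of 2 3] F2H True by auto
  next
    case False
    then consider "i < 2" "2 \<le> j" | "2 \<le> i" "j < 2" | "2 \<le> i" "2 \<le> j" by linarith
    then show ?thesis
    proof cases
      case 1
      then have "gcomm G a b \<in> F (1 + Suc j)" using F_gcomm[of a 1 b "Suc j"] a b H1 by auto
      then show ?thesis using 1 F_mono[of "Suc (i + j)" "1 + Suc j"] by auto
    next
      case 2
      then have "gcomm G a b \<in> F (Suc i + 1)" using F_gcomm[of a "Suc i" b 1] a b H1 by auto
      then show ?thesis using 2 F_mono[of "Suc (i + j)" "Suc i + 1"] by auto
    next
      case 3
      then have "gcomm G a b \<in> F (Suc i + Suc j)" using F_gcomm[of a "Suc i" b "Suc j"] a b by auto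
      then show ?thesis using 3 F_mono[of "Suc (i + j)" "Suc i + Suc j"] by auto
    qed
  qed
  moreover have "subgroup (?E i) G" for i
    using F_subgroup generate_is_subgroup[OF car] by (simp add: H_def)
  moreover have "?E (Suc i) \<subseteq> ?E i" for i
    using F_Suc F2H F_mono[of 2 "Suc (Suc i)"] by auto
  ultimately show ?thesis unfolding filtration_def by blast
qed

end

text \<open>Induction on the length. The induction hypothesis, used in groups generated by
  \<open>F 2\<close> and one further element, shows that the elements of \<open>F 2\<close> of order
  dividing \<open>q\<close> form a subgroup \<open>N\<close>, and that \<open>N\<close> contains the
  commutators of such elements of \<open>F 1\<close> with all of \<open>F 1\<close>. A filtration
  rebuilt from \<open>N\<close> then falls under \<open>mult_torsion_of_torsion_F2\<close>.\<close>

lemma (in group) mult_torsion_of_short_filtration: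
  assumes dv: "\<And>i. \<lbrakk>0 < i; i < p\<rbrakk> \<Longrightarrow> q dvd (q choose i)"
    and "2 \<le> s" "s \<le> p" "filtration G F" "F s = {\<one>}"
    and "x \<in> F 1" "x [^] (q::nat) = \<one>" "y \<in> F 1" "y [^] q = \<one>"
  shows "(x \<otimes> y) [^] q = \<one>"
  using assms(2-)
proof (induction s arbitrary: F x y rule: nat_induct_at_least)
  case base
  then interpret filtered_group G F by unfold_locales
  have "F p \<subseteq> {\<one>}" using F_mono[of 2 p] base by auto
  then have "F p = {\<one>}" using F_one by blast
  then show ?case
    by (intro mult_torsion_of_torsion_F2[of p q] dv) (use base in auto)
next
  case (Suc s)
  then interpret filtered_group G F by unfold_locales
  \<comment> \<open>The shortened filtration is trivial already at \<open>s\<close>, where its term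
    is \<open>F (Suc s)\<close>.\<close>
  have IH: "(a \<otimes> b) [^] q = \<one>"
    if z: "z \<in> F 1" and ab: "a \<in> generate G (insert z (F 2))" "b \<in> generate G (insert z (F 2))"
      and tors: "a [^] q = \<one>" "b [^] q = \<one>" for a b z
    using Suc.IH[OF _ cyclic_extension_filtration[OF z], of a b] Suc that by simp
  define N where "N = {z \<in> F 2. z [^] q = \<one>}"
  define S where "S = {z \<in> F 1. z [^] q = \<one>}"
  have S1: "S \<subseteq> F 1" and SC: "S \<subseteq> carrier G" using F_carrier by (auto simp: S_def)
  define L where "L = generate G S"
  have L1: "L \<subseteq> F 1" unfolding L_def by (rule generate_subgroup_incl[OF S1 F_subgroup])
  have F21: "F 2 \<subseteq> F 1" by (rule F_mono) simp
  have inv_tors: "inv z [^] q = \<one>" if "z [^] q = \<one>" "z \<in> carrier G" for z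
    using that by (simp add: nat_pow_inv)
  have N: "subgroup N G"
  proof (rule subgroupI)
    show "N \<subseteq> carrier G" using F_carrier by (auto simp: N_def)
    show "N \<noteq> {}" using F_one by (auto simp: N_def intro!: exI[of _ \<one>])
    show "inv a \<in> N" if "a \<in> N" for a
      using that inv_tors F_inv F_carrier by (auto simp: N_def)
    show "a \<otimes> b \<in> N" if "a \<in> N" "b \<in> N" for a b
    proof -
      have a: "a \<in> F 2" "a [^] q = \<one>" and b: "b \<in> F 2" "b [^] q = \<one>"
        using that by (simp_all add: N_def)
      have "(a \<otimes> b) [^] q = \<one>"
        by (rule IH[of a]) (use a b F21 in \<open>auto intro: generate.incl\<close>)
      then show ?thesis using F_mult[OF a(1) b(1)] by (simp add: N_def)
    qed
  qed
  have N_conj: "gconj G g m \<in> N" if "g \<in> F 1" "m \<in> N" for g m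
  proof -
    have m: "m \<in> F 2" "m [^] q = \<one>" using that by (simp_all add: N_def)
    have "gconj G g m [^] q = \<one>"
      using gconj_pow[of g m q] F_carrier[OF that(1)] F_carrier[OF m(1)] m(2)
      by (simp add: gconj_def)
    then show ?thesis using F_conj[OF that(1) m(1)] by (simp add: N_def)
  qed
  \<comment> \<open>The commutator is the product of \<open>z\<close> and a conjugate of its
    inverse. Both have trivial \<open>q\<close>-th power and both lie in the group generated by
    \<open>z\<close> and \<open>F 2\<close>, where the induction hypothesis applies.\<close>
  have S_comm: "gcomm G z g \<in> N" if z: "z \<in> S" and g: "g \<in> F 1" for z g
  proof -
    have zg: "z \<in> F 1" "z [^] q = \<one>" using z by (auto simp: S_def)
    note car = F_carrier[OF zg(1)] F_carrier[OF g]
    have c2: "gcomm G z g \<in> F 2" using F_gcomm[OF zg(1) g] by (simp add: numeral_2_eq_2)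
    have eq: "gconj G g (inv z) = inv z \<otimes> gcomm G z g" using car by (simp add: word_simps)
    have "gconj G g (inv z) \<in> generate G (insert z (F 2))"
      unfolding eq using c2 by (intro generate.eng generate.incl generate.inv) auto
    moreover have "gconj G g (inv z) [^] q = \<one>"
      using gconj_pow[of g "inv z" q] car inv_tors[OF zg(2)] by (simp add: gconj_def)
    ultimately have "(z \<otimes> gconj G g (inv z)) [^] q = \<one>"
      by (intro IH[OF zg(1), of z] zg(2)) (auto intro: generate.incl)
    moreover have "z \<otimes> gconj G g (inv z) = gcomm G z g"
      using car by (simp add: word_simps)
    ultimately show ?thesis using c2 by (simp add: N_def)
  qed
  have LL: "gcomm G a b \<in> N" if "a \<in> L" "b \<in> F 1" for a b
  proof (rule gcomm_generate_left[OF N SC F_carrier[OF that(2)]])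
    show "gconj G g m \<in> N" if "g \<in> generate G S" "m \<in> N" for g m
      using that N_conj L1 unfolding L_def by blast
  qed (use that S_comm in \<open>auto simp: L_def\<close>)
  \<comment> \<open>\<open>E 1 = L\<close> contains \<open>x\<close> and \<open>y\<close>, and
    \<open>E 2\<close> has exponent dividing \<open>q\<close> by construction; \<open>LL\<close>
    supplies the commutator condition.\<close>
  define E where "E i = (if i < 2 then L else N \<inter> F i)" for i
  have E_F: "E i \<subseteq> F (max 1 i)" for i
    using L1 by (cases "i < 2") (auto simp: E_def less_2_cases_iff max_def)
  have "N \<subseteq> S" using F21 by (auto simp: N_def S_def)
  then have NL: "N \<subseteq> L" unfolding L_def by (auto intro: generate.incl)
  have "filtration G E"
    unfolding filtration_def
  proof (intro conjI allI ballI)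
    show "subgroup (E i) G" for i
      using generate_is_subgroup[OF SC] subgroups_Inter_pair[OF N F_subgroup]
      by (simp add: E_def L_def)
    show "E (Suc i) \<subseteq> E i" for i using NL F_Suc[of i] by (auto simp: E_def)
  next
    fix i j a b assume a: "a \<in> E i" and b: "b \<in> E j"
    have EL: "E i \<subseteq> L" for i using NL by (auto simp: E_def)
    then have cN: "gcomm G a b \<in> N" using LL L1 a b by blast
    have "gcomm G a b \<in> F (max 1 i + max 1 j)" using F_gcomm E_F a b by blast
    moreover have "F (max 1 i + max 1 j) \<subseteq> F (i + j)" by (rule F_mono) simp
    ultimately show "gcomm G a b \<in> E (i + j)" using cN NL by (auto simp: E_def)
  qed
  then interpret E: filtered_group G E by unfold_locales
  show ?case
  proof (rule E.mult_torsion_of_torsion_F2[of p q])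
    have "E p \<subseteq> {\<one>}" using F_mono[of "Suc s" p] Suc by (auto simp: E_def)
    then show "E p = {\<one>}" using E.F_one by blast
    show "a [^] q = \<one>" if "a \<in> E 2" for a using that by (simp add: E_def N_def)
    have "x \<in> S" "y \<in> S" using Suc.prems by (simp_all add: S_def)
    then show "x \<in> E 1" "y \<in> E 1" by (simp_all add: E_def L_def generate.incl)
  qed (use Suc.prems dv in blast)+
qed

lemma (in group_hom) hom_gcomm:
  "\<lbrakk>x \<in> carrier G; y \<in> carrier G\<rbrakk> \<Longrightarrow> h (gcomm G x y) = gcomm H (h x) (h y)"
  by (simp add: gcomm_def)

lemma (in filtered_group) image_filtration:
  assumes "group_hom G H \<phi>"
  shows "filtration H (\<lambda>i. \<phi> ` F i)"
proof -
  interpret \<phi>: group_hom G H \<phi> by (rule assms)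
  have "gcomm H (\<phi> x) (\<phi> y) \<in> \<phi> ` F (i + j)" if "x \<in> F i" "y \<in> F j" for x y i j
    using F_gcomm[OF that] \<phi>.hom_gcomm[of x y] F_carrier that by (metis imageI)
  moreover have "\<phi> ` F (Suc i) \<subseteq> \<phi> ` F i" for i using F_Suc by blast
  ultimately show ?thesis
    unfolding filtration_def using \<phi>.subgroup_img_is_subgroup[OF F_subgroup] by blast
qed

text \<open>The hypothesis on \<open>F 0\<close> makes \<open>F p\<close> normal. In the quotient by
  it the image filtration is trivial at \<open>p\<close>, so the absolute statement applies with
  \<open>s = p\<close>.\<close>

lemma (in filtered_group) mult_torsion_mod:
  assumes dv: "\<And>i. \<lbrakk>0 < i; i < p\<rbrakk> \<Longrightarrow> q dvd (q choose i)" and p: "2 \<le> p"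
    and full: "F 0 = carrier G"
    and x: "x \<in> F 1" "x [^] (q::nat) \<in> F p" and y: "y \<in> F 1" "y [^] q \<in> F p"
  shows "(x \<otimes> y) [^] q \<in> F p"
proof -
  have nrm: "F p \<lhd> G"
    unfolding normal_inv_iff
    using F_subgroup F_conj[of _ 0 _ p] full by (auto simp: gconj_def)
  interpret N: normal "F p" G by (rule nrm)
  let ?Q = "G Mod F p"
  interpret \<phi>: group_hom G ?Q "\<lambda>a. F p #> a"
    by (intro group_hom.intro group_hom_axioms.intro is_group N.factorgroup_is_group
        N.r_coset_hom_Mod)
  have one_iff: "F p #> a = \<one>\<^bsub>?Q\<^esub> \<longleftrightarrow> a \<in> F p" if "a \<in> carrier G" for a
    using that coset_join1[OF _ that N.subgroup_axioms] coset_join2[OF that N.subgroup_axioms]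
    by (auto simp: FactGroup_def)
  have pow: "(F p #> a) [^]\<^bsub>?Q\<^esub> q = F p #> (a [^] q)" if "a \<in> carrier G" for a
    using \<phi>.hom_nat_pow[OF that] by simp
  note car = F_carrier[OF x(1)] F_carrier[OF y(1)]
  have triv: "(\<lambda>a. F p #> a) ` F p = {\<one>\<^bsub>?Q\<^esub>}"
  proof -
    have "F p #> a = \<one>\<^bsub>?Q\<^esub>" if "a \<in> F p" for a using one_iff that F_carrier by blast
    then show ?thesis using F_one[of p] by blast
  qed
  have "((F p #> x) \<otimes>\<^bsub>?Q\<^esub> (F p #> y)) [^]\<^bsub>?Q\<^esub> q = \<one>\<^bsub>?Q\<^esub>"
  proof (rule group.mult_torsion_of_short_filtration[OF N.factorgroup_is_group dv p order_refl
        image_filtration[OF \<phi>.group_hom_axioms] triv])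
    show "F p #> x \<in> (#>) (F p) ` F 1" "F p #> y \<in> (#>) (F p) ` F 1" using x y by blast+
    show "(F p #> x) [^]\<^bsub>?Q\<^esub> q = \<one>\<^bsub>?Q\<^esub>" "(F p #> y) [^]\<^bsub>?Q\<^esub> q = \<one>\<^bsub>?Q\<^esub>"
      using pow one_iff car x y by simp_all
  qed
  moreover have "(F p #> x) \<otimes>\<^bsub>?Q\<^esub> (F p #> y) = F p #> (x \<otimes> y)"
    using \<phi>.hom_mult[OF car] by simp
  ultimately have "F p #> ((x \<otimes> y) [^] q) = \<one>\<^bsub>?Q\<^esub>"
    using pow[of "x \<otimes> y"] car by (metis m_closed)
  then show ?thesis using car one_iff by simp
qed

section \<open>Presented groups\<close>

lemma pres_class_eq_iff: "pres_class S Rs u = pres_class S Rs v \<longleftrightarrow> pres_eq S Rs u v"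
proof
  assume "pres_class S Rs u = pres_class S Rs v"
  then show "pres_eq S Rs u v"
    unfolding pres_class_def using pres_eq.refl[of S Rs v] by blast
next
  assume uv: "pres_eq S Rs u v"
  have "pres_eq S Rs u w \<longleftrightarrow> pres_eq S Rs v w" for w
    using pres_eq.trans[OF uv, of w] pres_eq.trans[OF pres_eq.sym[OF uv], of w] by blast
  then show "pres_class S Rs u = pres_class S Rs v" by (simp add: pres_class_def)
qed

lemma pres_eq_append:
  assumes "pres_eq S Rs u u'" "pres_eq S Rs v v'"
  shows "pres_eq S Rs (u @ v) (u' @ v')"
proof (rule pres_eq.trans)
  show "pres_eq S Rs (u @ v) (u' @ v)" using pres_eq.cong[OF assms(1), of "[]" v] by simp
  show "pres_eq S Rs (u' @ v) (u' @ v')" using pres_eq.cong[OF assms(2), of u' "[]"] by simp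
qed

lemma presented_group_one: "\<one>\<^bsub>presented_group S Rs\<^esub> = pres_class S Rs []"
  by (simp add: presented_group_def)

text \<open>The definition takes a union over all pairs of representatives; by congruence they all
  yield the same class.\<close>

lemma presented_group_mult:
  "pres_class S Rs u \<otimes>\<^bsub>presented_group S Rs\<^esub> pres_class S Rs v = pres_class S Rs (u @ v)"
proof -
  have "pres_class S Rs (a @ b) = pres_class S Rs (u @ v)"
    if "a \<in> pres_class S Rs u" "b \<in> pres_class S Rs v" for a b
    using pres_eq_append[of S Rs u a v b] that
    unfolding pres_class_eq_iff by (simp add: pres_class_def pres_eq.sym[of _ _ "u @ v"])
  moreover have "w \<in> pres_class S Rs w" for w by (simp add: pres_class_def pres_eq.refl)
  ultimately have "{pres_class S Rs (a @ b) |a b. a \<in> pres_class S Rs u \<and> b \<in> pres_class S Rs v}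
      = {pres_class S Rs (u @ v)}"
    by blast
  then show ?thesis by (simp add: presented_group_def)
qed

definition word_over :: "'x set \<Rightarrow> 'x word \<Rightarrow> bool" where
  "word_over S w \<longleftrightarrow> (\<forall>l\<in>set w. fst l \<in> S)"

lemma word_over_simps [simp]:
  "word_over S []"
  "word_over S (l # w) \<longleftrightarrow> fst l \<in> S \<and> word_over S w"
  "word_over S (u @ v) \<longleftrightarrow> word_over S u \<and> word_over S v"
  by (auto simp: word_over_def)

lemma presented_group_carrier:
  "carrier (presented_group S Rs) = {pres_class S Rs w | w. word_over S w}"
  by (simp add: presented_group_def word_over_def)

lemma pres_class_in_carrier:
  "word_over S w \<Longrightarrow> pres_class S Rs w \<in> carrier (presented_group S Rs)"
  by (auto simp: presented_group_carrier)

lemma pres_eq_inverse: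
  "word_over S w \<Longrightarrow> \<exists>v. word_over S v \<and> pres_eq S Rs (v @ w) []"
proof (induction w)
  case Nil
  then show ?case by (intro exI[of _ "[]"]) (simp add: pres_eq.refl)
next
  case (Cons l w)
  then obtain v where v: "word_over S v" "pres_eq S Rs (v @ w) []" by auto
  obtain x b where l: "l = (x, b)" by (cases l)
  have "pres_eq S Rs (v @ [(x, \<not> b), (x, \<not> \<not> b)] @ w) (v @ [] @ w)"
    by (intro pres_eq.cong pres_eq.cancel) (use Cons.prems l in simp)
  then have "pres_eq S Rs ((v @ [(x, \<not> b)]) @ l # w) []"
    using pres_eq.trans[OF _ v(2)] l by simp
  then show ?case using v(1) Cons.prems l by (intro exI[of _ "v @ [(x, \<not> b)]"]) simp
qed

lemma group_presented_group: "group (presented_group S Rs)"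
proof (rule groupI)
  fix A B C
  assume "A \<in> carrier (presented_group S Rs)" "B \<in> carrier (presented_group S Rs)"
    "C \<in> carrier (presented_group S Rs)"
  then obtain u v w where *: "word_over S u" "word_over S v"
    "A = pres_class S Rs u" "B = pres_class S Rs v" "C = pres_class S Rs w"
    unfolding presented_group_carrier by blast
  show "A \<otimes>\<^bsub>presented_group S Rs\<^esub> B \<in> carrier (presented_group S Rs)"
    using * by (simp add: presented_group_mult pres_class_in_carrier)
  show "A \<otimes>\<^bsub>presented_group S Rs\<^esub> B \<otimes>\<^bsub>presented_group S Rs\<^esub> C
      = A \<otimes>\<^bsub>presented_group S Rs\<^esub> (B \<otimes>\<^bsub>presented_group S Rs\<^esub> C)"
    using * by (simp add: presented_group_mult)
  show "\<one>\<^bsub>presented_group S Rs\<^esub> \<otimes>\<^bsub>presented_group S Rs\<^esub> A = A"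
    using * by (simp add: presented_group_mult presented_group_one)
  obtain v' where "word_over S v'" "pres_eq S Rs (v' @ u) []"
    using pres_eq_inverse *(1) by blast
  then show "\<exists>B\<in>carrier (presented_group S Rs). B \<otimes>\<^bsub>presented_group S Rs\<^esub> A = \<one>\<^bsub>presented_group S Rs\<^esub>"
    using *(3) by (intro bexI[of _ "pres_class S Rs v'"])
      (auto simp: presented_group_mult presented_group_one pres_class_eq_iff pres_class_in_carrier)
next
  show "\<one>\<^bsub>presented_group S Rs\<^esub> \<in> carrier (presented_group S Rs)"
    by (simp add: presented_group_one pres_class_in_carrier)
qed

abbreviation pres_gen :: "'x set \<Rightarrow> ('x word \<times> 'x word) set \<Rightarrow> 'x \<Rightarrow> 'x word set" where
  "pres_gen S Rs x \<equiv> pres_class S Rs [(x, True)]"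

lemma presented_group_inv_letter:
  assumes "x \<in> S"
  shows "pres_class S Rs [(x, False)] = inv\<^bsub>presented_group S Rs\<^esub> pres_gen S Rs x"
proof (rule group.inv_equality[OF group_presented_group, symmetric])
  show "pres_class S Rs [(x, False)] \<otimes>\<^bsub>presented_group S Rs\<^esub> pres_gen S Rs x
      = \<one>\<^bsub>presented_group S Rs\<^esub>"
    using pres_eq.cancel[OF assms, of Rs False]
    by (simp add: presented_group_mult presented_group_one pres_class_eq_iff)
qed (use assms in \<open>simp_all add: pres_class_in_carrier\<close>)

lemma presented_group_generate:
  "carrier (presented_group S Rs) = generate (presented_group S Rs) (pres_gen S Rs ` S)"
proof
  interpret group "presented_group S Rs" by (rule group_presented_group)
  show "generate (presented_group S Rs) (pres_gen S Rs ` S) \<subseteq> carrier (presented_group S Rs)"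
    by (rule generate_incl) (auto intro: pres_class_in_carrier)
  have "pres_class S Rs w \<in> generate (presented_group S Rs) (pres_gen S Rs ` S)"
    if "word_over S w" for w
    using that
  proof (induction w)
    case Nil
    show ?case
      unfolding presented_group_one[symmetric] by (rule generate.one)
  next
    case (Cons l w)
    obtain x b where l: "l = (x, b)" by (cases l)
    have x: "x \<in> S" using Cons.prems l by simp
    have "pres_class S Rs [l] \<in> generate (presented_group S Rs) (pres_gen S Rs ` S)"
    proof (cases b)
      case True
      then show ?thesis using x l by (auto intro: generate.incl)
    next
      case False
      then show ?thesis using x l by (simp add: presented_group_inv_letter generate.inv)
    qed
    then have "pres_class S Rs [l] \<otimes>\<^bsub>presented_group S Rs\<^esub> pres_class S Rs w
        \<in> generate (presented_group S Rs) (pres_gen S Rs ` S)"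
      using Cons by (intro generate.eng) auto
    then show ?case by (simp add: presented_group_mult)
  qed
  then show "carrier (presented_group S Rs)
      \<subseteq> generate (presented_group S Rs) (pres_gen S Rs ` S)"
    unfolding presented_group_carrier by blast
qed

primrec word_eval :: "('b, 'c) monoid_scheme \<Rightarrow> ('x \<Rightarrow> 'b) \<Rightarrow> 'x word \<Rightarrow> 'b" where
  "word_eval H f [] = \<one>\<^bsub>H\<^esub>"
| "word_eval H f (l # w) =
     (if snd l then f (fst l) else inv\<^bsub>H\<^esub> f (fst l)) \<otimes>\<^bsub>H\<^esub> word_eval H f w"

context group
begin

lemma word_eval_closed:
  "\<lbrakk>f \<in> S \<rightarrow> carrier G; word_over S w\<rbrakk> \<Longrightarrow> word_eval G f w \<in> carrier G"
  by (induction w) (auto simp: Pi_def)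

lemma word_eval_append:
  "\<lbrakk>f \<in> S \<rightarrow> carrier G; word_over S u; word_over S v\<rbrakk>
    \<Longrightarrow> word_eval G f (u @ v) = word_eval G f u \<otimes> word_eval G f v"
  by (induction u) (auto simp: m_assoc word_eval_closed Pi_iff)

text \<open>Contexts in \<open>pres_eq\<close> may contain letters outside \<open>S\<close>, where
  \<open>f\<close> is not controlled. Being a word over \<open>S\<close> is therefore carried along
  as an invariant, which also covers the intermediate word of a transitivity step.\<close>

lemma word_eval_respects:
  assumes f: "f \<in> S \<rightarrow> carrier G"
    and Rs: "\<And>u v. (u, v) \<in> Rs \<Longrightarrow>
      word_over S u \<and> word_over S v \<and> word_eval G f u = word_eval G f v"
    and uv: "pres_eq S Rs u v"
  shows "word_over S u = word_over S v \<and>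
    (word_over S u \<longrightarrow> word_eval G f u = word_eval G f v)"
  using uv
proof (induction rule: pres_eq.induct)
  case (cancel x b)
  then show ?case using f by (auto simp: Pi_iff)
next
  case (cong u v a c)
  then show ?case using f by (auto simp: word_eval_append)
qed (use Rs in auto)

text \<open>Von Dyck's theorem. The homomorphism evaluates a chosen representative, and
  \<open>word_eval_respects\<close> makes the choice immaterial.\<close>

lemma presented_group_universal:
  assumes f: "f \<in> S \<rightarrow> carrier G"
    and Rs: "\<And>u v. (u, v) \<in> Rs \<Longrightarrow>
      word_over S u \<and> word_over S v \<and> word_eval G f u = word_eval G f v"
  shows "\<exists>\<phi>\<in>hom (presented_group S Rs) G. \<forall>x\<in>S. \<phi> (pres_gen S Rs x) = f x"
proof
  define \<phi> where "\<phi> A = word_eval G f (SOME w. w \<in> A)" for A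
  have \<phi>: "\<phi> (pres_class S Rs w) = word_eval G f w" if "word_over S w" for w
  proof -
    have "w \<in> pres_class S Rs w" by (simp add: pres_class_def pres_eq.refl)
    then have "(SOME v. v \<in> pres_class S Rs w) \<in> pres_class S Rs w" by (rule someI)
    then have "pres_eq S Rs w (SOME v. v \<in> pres_class S Rs w)" by (simp add: pres_class_def)
    from word_eval_respects[OF f Rs this] that show ?thesis by (simp add: \<phi>_def)
  qed
  show "\<phi> \<in> hom (presented_group S Rs) G"
    unfolding hom_def presented_group_carrier using f
    by (auto simp: presented_group_mult \<phi> word_eval_append word_eval_closed[OF f])
  show "\<forall>x\<in>S. \<phi> (pres_gen S Rs x) = f x"
    using f by (auto simp: \<phi> Pi_iff)
qed

end

section \<open>The exterior square as a crossed module\<close>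

context group
begin

lemma lcs_subset_carrier: "lcs G n \<subseteq> carrier G"
proof (induction n)
  case (Suc n)
  then show ?case by (auto intro!: generate_incl)
qed simp

lemma lcs_subgroup: "subgroup (lcs G n) G"
proof (cases n)
  case (Suc m)
  then show ?thesis
    using lcs_subset_carrier[of m] by (auto intro!: generate_is_subgroup)
qed (simp add: subgroup_self)

lemma lcs_carrier: "x \<in> lcs G n \<Longrightarrow> x \<in> carrier G"
  using lcs_subset_carrier by blast

lemma gcomm_in_lcs_Suc: "\<lbrakk>x \<in> lcs G n; y \<in> carrier G\<rbrakk> \<Longrightarrow> gcomm G x y \<in> lcs G (Suc n)"
  by (auto intro: generate.incl)

lemma gconj_gcomm:
  "\<lbrakk>g \<in> carrier G; x \<in> carrier G; y \<in> carrier G\<rbrakk>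
    \<Longrightarrow> gconj G g (gcomm G x y) = gcomm G (gconj G g x) (gconj G g y)"
  by (simp add: word_simps)

lemma hom_preserves_generate:
  assumes f: "f \<in> hom G H" and H: "group H" and A: "A \<subseteq> carrier G" and M: "subgroup M H"
    and gen: "\<And>a. a \<in> A \<Longrightarrow> f a \<in> M" and x: "x \<in> generate G A"
  shows "f x \<in> M"
proof -
  interpret f: group_hom G H f
    using f H by (intro group_hom.intro group_hom_axioms.intro is_group)
  show ?thesis
    using x
  proof (induction x rule: generate.induct)
    case one
    then show ?case using subgroup.one_closed[OF M] by simp
  next
    case (inv a)
    then have "a \<in> carrier G" using A by blast
    then show ?case using subgroup.m_inv_closed[OF M gen[OF inv]] by simp
  next
    case (eng a b)
    then have "a \<in> carrier G" "b \<in> carrier G" using generate_in_carrier[OF A] by blast+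
    then show ?case using subgroup.m_closed[OF M eng(3,4)] by simp
  qed (use gen in auto)
qed

lemma gconj_in_lcs:
  assumes "x \<in> lcs G n" "g \<in> carrier G"
  shows "gconj G g x \<in> lcs G n"
  using assms(1)
proof (induction n arbitrary: x)
  case 0
  then show ?case using assms by simp
next
  case (Suc n)
  let ?A = "{gcomm G x y | x y. x \<in> lcs G n \<and> y \<in> carrier G}"
  have "?A \<subseteq> carrier G" using lcs_carrier by blast
  then show ?case
  proof (rule hom_preserves_generate[OF gconj_hom[OF assms(2)] is_group _ lcs_subgroup])
    fix a assume "a \<in> ?A"
    then obtain u v where "a = gcomm G u v" "u \<in> lcs G n" "v \<in> carrier G" by blast
    then show "gconj G g a \<in> lcs G (Suc n)"
      using Suc.IH[of u] gcomm_in_lcs_Suc assms(2) lcs_carrier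
      by (simp add: gconj_gcomm del: lcs.simps)
  qed (use Suc.prems in simp)
qed

lemma lcs_Suc_subset: "lcs G (Suc n) \<subseteq> lcs G n"
proof
  fix x assume x: "x \<in> lcs G (Suc n)"
  let ?A = "{gcomm G x y | x y. x \<in> lcs G n \<and> y \<in> carrier G}"
  have "?A \<subseteq> lcs G n"
  proof
    fix a assume "a \<in> ?A"
    then obtain u v where a: "a = gcomm G u v" "u \<in> lcs G n" "v \<in> carrier G" by blast
    have "a = u \<otimes> gconj G v (inv u)" using a lcs_carrier by (simp add: word_simps)
    then show "a \<in> lcs G n"
      using a gconj_in_lcs lcs_subgroup[of n] by (simp add: subgroup.m_closed subgroup.m_inv_closed)
  qed
  from generate_subgroup_incl[OF this lcs_subgroup] show "x \<in> lcs G n" using x by auto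
qed

lemma lcs_antimono: "m \<le> n \<Longrightarrow> lcs G n \<subseteq> lcs G m"
  by (rule lift_Suc_antimono_le[of "lcs G", OF lcs_Suc_subset])

end

section \<open>Exterior pairings and their crossed module identities\<close>

definition semidirect ::
  "('t, 'd) monoid_scheme \<Rightarrow> ('a, 'b) monoid_scheme \<Rightarrow> ('a \<Rightarrow> 't \<Rightarrow> 't) \<Rightarrow> ('t \<times> 'a) monoid" where
  "semidirect T G act = \<lparr>carrier = carrier T \<times> carrier G,
     monoid.mult = (\<lambda>x y. (fst x \<otimes>\<^bsub>T\<^esub> act (snd x) (fst y), snd x \<otimes>\<^bsub>G\<^esub> snd y)),
     one = (\<one>\<^bsub>T\<^esub>, \<one>\<^bsub>G\<^esub>)\<rparr>"

lemma semidirect_simps [simp]: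
  "carrier (semidirect T G act) = carrier T \<times> carrier G"
  "(t, g) \<otimes>\<^bsub>semidirect T G act\<^esub> (u, h) = (t \<otimes>\<^bsub>T\<^esub> act g u, g \<otimes>\<^bsub>G\<^esub> h)"
  "\<one>\<^bsub>semidirect T G act\<^esub> = (\<one>\<^bsub>T\<^esub>, \<one>\<^bsub>G\<^esub>)"
  by (simp_all add: semidirect_def)

text \<open>An abstract exterior square, independent of words and presentations. Each
  \<open>act g\<close> is only assumed to be an endomorphism with prescribed values on generators;
  the action laws follow in \<open>act_one_left\<close> and \<open>act_act\<close>.\<close>

locale exterior_pairing = G: group G + T: group T
  for G :: "('a, 'b) monoid_scheme" and T :: "('t, 'd) monoid_scheme" +
  fixes w :: "'a \<Rightarrow> 'a \<Rightarrow> 't" and act :: "'a \<Rightarrow> 't \<Rightarrow> 't" and bd :: "'t \<Rightarrow> 'a"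
  assumes w_closed: "\<lbrakk>a \<in> carrier G; b \<in> carrier G\<rbrakk> \<Longrightarrow> w a b \<in> carrier T"
    and carrier_T: "carrier T = generate T {w a b | a b. a \<in> carrier G \<and> b \<in> carrier G}"
    and w_mult_left_conj: "\<lbrakk>a \<in> carrier G; a' \<in> carrier G; b \<in> carrier G\<rbrakk>
      \<Longrightarrow> w (a \<otimes>\<^bsub>G\<^esub> a') b = w (gconj G a a') (gconj G a b) \<otimes>\<^bsub>T\<^esub> w a b"
    and w_mult_right_conj: "\<lbrakk>a \<in> carrier G; b \<in> carrier G; b' \<in> carrier G\<rbrakk>
      \<Longrightarrow> w a (b \<otimes>\<^bsub>G\<^esub> b') = w a b \<otimes>\<^bsub>T\<^esub> w (gconj G b a) (gconj G b b')"
    and w_self: "a \<in> carrier G \<Longrightarrow> w a a = \<one>\<^bsub>T\<^esub>"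
    and act_hom: "g \<in> carrier G \<Longrightarrow> act g \<in> hom T T"
    and act_w: "\<lbrakk>g \<in> carrier G; a \<in> carrier G; b \<in> carrier G\<rbrakk>
      \<Longrightarrow> act g (w a b) = w (gconj G g a) (gconj G g b)"
    and bd_hom: "bd \<in> hom T G"
    and bd_w: "\<lbrakk>a \<in> carrier G; b \<in> carrier G\<rbrakk> \<Longrightarrow> bd (w a b) = gcomm G a b"
begin

interpretation bd: group_hom T G bd
  using bd_hom by unfold_locales

lemma act_group_hom: "g \<in> carrier G \<Longrightarrow> group_hom T T (act g)"
  using act_hom by (intro group_hom.intro group_hom_axioms.intro T.is_group)

lemma act_closed [simp]: "\<lbrakk>g \<in> carrier G; t \<in> carrier T\<rbrakk> \<Longrightarrow> act g t \<in> carrier T"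
  using group_hom.hom_closed[OF act_group_hom] by blast

lemma act_mult: "\<lbrakk>g \<in> carrier G; t \<in> carrier T; u \<in> carrier T\<rbrakk>
    \<Longrightarrow> act g (t \<otimes>\<^bsub>T\<^esub> u) = act g t \<otimes>\<^bsub>T\<^esub> act g u"
  using group_hom.hom_mult[OF act_group_hom] by blast

lemma act_inv: "\<lbrakk>g \<in> carrier G; t \<in> carrier T\<rbrakk>
    \<Longrightarrow> act g (inv\<^bsub>T\<^esub> t) = inv\<^bsub>T\<^esub> act g t"
  using group_hom.hom_inv[OF act_group_hom] by blast

lemma act_one_right [simp]: "g \<in> carrier G \<Longrightarrow> act g \<one>\<^bsub>T\<^esub> = \<one>\<^bsub>T\<^esub>"
  using group_hom.hom_one[OF act_group_hom] by blast

lemma T_induct [consumes 1, case_names w inv mult]: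
  assumes t: "t \<in> carrier T"
    and w: "\<And>a b. \<lbrakk>a \<in> carrier G; b \<in> carrier G\<rbrakk> \<Longrightarrow> P (w a b)"
    and inv: "\<And>t. \<lbrakk>t \<in> carrier T; P t\<rbrakk> \<Longrightarrow> P (inv\<^bsub>T\<^esub> t)"
    and mult: "\<And>t u. \<lbrakk>t \<in> carrier T; u \<in> carrier T; P t; P u\<rbrakk> \<Longrightarrow> P (t \<otimes>\<^bsub>T\<^esub> u)"
  shows "P t"
proof -
  have "t \<in> generate T {w a b | a b. a \<in> carrier G \<and> b \<in> carrier G}" using t carrier_T by simp
  then show ?thesis
  proof (induction t rule: generate.induct)
    case one
    then show ?case using w[of "\<one>\<^bsub>G\<^esub>" "\<one>\<^bsub>G\<^esub>"] w_self by simp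
  next
    case (incl t)
    then show ?case using w by blast
  next
    case (inv t)
    then show ?case using w assms(3) w_closed by blast
  next
    case (eng t u)
    then show ?case using mult carrier_T by simp
  qed
qed

lemma hom_eqI:
  assumes f: "f \<in> hom T T" and g: "g \<in> hom T T"
    and eq: "\<And>a b. \<lbrakk>a \<in> carrier G; b \<in> carrier G\<rbrakk> \<Longrightarrow> f (w a b) = g (w a b)"
    and t: "t \<in> carrier T"
  shows "f t = g t"
proof -
  interpret f: group_hom T T f using f by unfold_locales
  interpret g: group_hom T T g using g by unfold_locales
  show ?thesis using t by (induction rule: T_induct) (simp_all add: eq)
qed

lemma act_one_left [simp]: "t \<in> carrier T \<Longrightarrow> act \<one>\<^bsub>G\<^esub> t = t"
proof (rule hom_eqI)
  show "act \<one>\<^bsub>G\<^esub> \<in> hom T T" by (simp add: act_hom)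
  show "(\<lambda>t. t) \<in> hom T T" by (simp add: hom_def)
qed (auto simp: act_w gconj_def)

lemma act_act:
  assumes g: "g \<in> carrier G" and h: "h \<in> carrier G" and t: "t \<in> carrier T"
  shows "act g (act h t) = act (g \<otimes>\<^bsub>G\<^esub> h) t"
proof (rule hom_eqI[OF _ _ _ t])
  show "(\<lambda>t. act g (act h t)) \<in> hom T T"
    using g h by (auto simp: hom_def act_mult)
qed (use g h in \<open>auto simp: act_hom act_w G.word_simps\<close>)

lemma act_inv_cancel:
  assumes "g \<in> carrier G" "t \<in> carrier T"
  shows "act (inv\<^bsub>G\<^esub> g) (act g t) = t" "act g (act (inv\<^bsub>G\<^esub> g) t) = t"
  using assms by (simp_all add: act_act)

lemma w_one_left: "b \<in> carrier G \<Longrightarrow> w \<one>\<^bsub>G\<^esub> b = \<one>\<^bsub>T\<^esub>"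
  using w_mult_left_conj[of "\<one>\<^bsub>G\<^esub>" "\<one>\<^bsub>G\<^esub>" b] w_closed[of "\<one>\<^bsub>G\<^esub>" b]
  by (simp add: gconj_def)

lemma w_one_right: "a \<in> carrier G \<Longrightarrow> w a \<one>\<^bsub>G\<^esub> = \<one>\<^bsub>T\<^esub>"
  using w_mult_right_conj[of a "\<one>\<^bsub>G\<^esub>" "\<one>\<^bsub>G\<^esub>"] w_closed[of a "\<one>\<^bsub>G\<^esub>"]
  by (simp add: gconj_def)

lemma w_mult_left: "\<lbrakk>a \<in> carrier G; a' \<in> carrier G; b \<in> carrier G\<rbrakk>
    \<Longrightarrow> w (a \<otimes>\<^bsub>G\<^esub> a') b = act a (w a' b) \<otimes>\<^bsub>T\<^esub> w a b"
  by (simp add: w_mult_left_conj act_w)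

lemma w_mult_right: "\<lbrakk>a \<in> carrier G; b \<in> carrier G; b' \<in> carrier G\<rbrakk>
    \<Longrightarrow> w a (b \<otimes>\<^bsub>G\<^esub> b') = w a b \<otimes>\<^bsub>T\<^esub> act b (w a b')"
  by (simp add: w_mult_right_conj act_w)

text \<open>Expand the trivial wedge of \<open>a \<otimes> b\<close> with itself in both entries;
  \<open>w a a\<close> and \<open>w b b\<close> drop out.\<close>

lemma w_swap:
  assumes a: "a \<in> carrier G" and b: "b \<in> carrier G"
  shows "w b a = inv\<^bsub>T\<^esub> w a b"
proof -
  note c = w_closed[OF a b] w_closed[OF b a]
  have "w (a \<otimes>\<^bsub>G\<^esub> b) (a \<otimes>\<^bsub>G\<^esub> b)
      = act a (w b (a \<otimes>\<^bsub>G\<^esub> b)) \<otimes>\<^bsub>T\<^esub> w a (a \<otimes>\<^bsub>G\<^esub> b)"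
    by (rule w_mult_left) (use a b in auto)
  also have "\<dots> = act a (w b a \<otimes>\<^bsub>T\<^esub> w a b)"
    using a b c by (simp add: w_mult_right w_self act_mult)
  finally have "act a (w b a \<otimes>\<^bsub>T\<^esub> w a b) = \<one>\<^bsub>T\<^esub>" using a b by (simp add: w_self)
  then have "act (inv\<^bsub>G\<^esub> a) (act a (w b a \<otimes>\<^bsub>T\<^esub> w a b)) = \<one>\<^bsub>T\<^esub>" using a by simp
  then have "w b a \<otimes>\<^bsub>T\<^esub> w a b = \<one>\<^bsub>T\<^esub>" using a c by (simp add: act_inv_cancel)
  then show ?thesis using c by (intro T.inv_equality[symmetric])
qed

lemma w_inv_right:
  assumes a: "a \<in> carrier G" and b: "b \<in> carrier G"
  shows "act b (w a (inv\<^bsub>G\<^esub> b)) = inv\<^bsub>T\<^esub> w a b"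
proof -
  have "w a b \<otimes>\<^bsub>T\<^esub> act b (w a (inv\<^bsub>G\<^esub> b)) = \<one>\<^bsub>T\<^esub>"
    using w_mult_right[of a b "inv\<^bsub>G\<^esub> b"] a b by (simp add: w_one_right)
  then have "act b (w a (inv\<^bsub>G\<^esub> b)) \<otimes>\<^bsub>T\<^esub> w a b = \<one>\<^bsub>T\<^esub>"
    by (rule T.inv_comm) (use a b w_closed in auto)
  then show ?thesis using a b w_closed by (intro T.inv_equality[symmetric]) auto
qed

lemma w_inv_left:
  assumes a: "a \<in> carrier G" and b: "b \<in> carrier G"
  shows "act a (w (inv\<^bsub>G\<^esub> a) b) = inv\<^bsub>T\<^esub> w a b"
proof -
  have "act a (w (inv\<^bsub>G\<^esub> a) b) \<otimes>\<^bsub>T\<^esub> w a b = \<one>\<^bsub>T\<^esub>"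
    using w_mult_left[of a "inv\<^bsub>G\<^esub> a" b] a b by (simp add: w_one_left)
  then show ?thesis using a b w_closed by (intro T.inv_equality[symmetric]) auto
qed

text \<open>Expand \<open>w (g \<otimes> a) (h \<otimes> b)\<close> in both orders and cancel the outer factors.\<close>

lemma act_mult_comm:
  assumes car: "g \<in> carrier G" "h \<in> carrier G" and t: "t \<in> carrier T"
  shows "act (g \<otimes>\<^bsub>G\<^esub> h) t \<otimes>\<^bsub>T\<^esub> w g h = w g h \<otimes>\<^bsub>T\<^esub> act (h \<otimes>\<^bsub>G\<^esub> g) t"
proof -
  note c = w_closed[OF car]
  have "act (g \<otimes>\<^bsub>G\<^esub> h) t = gconj T (w g h) (act (h \<otimes>\<^bsub>G\<^esub> g) t)"
  proof (rule hom_eqI[OF _ _ _ t])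
    show "act (g \<otimes>\<^bsub>G\<^esub> h) \<in> hom T T" using car by (simp add: act_hom)
    show "(\<lambda>t. gconj T (w g h) (act (h \<otimes>\<^bsub>G\<^esub> g) t)) \<in> hom T T"
      using car c by (auto simp: hom_def act_mult T.word_simps)
  next
    fix a b assume ab: "a \<in> carrier G" "b \<in> carrier G"
    have cl: "w g b \<in> carrier T" "w a h \<in> carrier T" "w a b \<in> carrier T"
      using car ab w_closed by auto
    have "w (g \<otimes>\<^bsub>G\<^esub> a) (h \<otimes>\<^bsub>G\<^esub> b) = act g (w a h) \<otimes>\<^bsub>T\<^esub>
        (act (g \<otimes>\<^bsub>G\<^esub> h) (w a b) \<otimes>\<^bsub>T\<^esub> w g h) \<otimes>\<^bsub>T\<^esub> act h (w g b)"
      using car ab cl c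
      by (subst w_mult_left) (simp_all add: w_mult_right act_mult act_act T.m_assoc)
    moreover have "w (g \<otimes>\<^bsub>G\<^esub> a) (h \<otimes>\<^bsub>G\<^esub> b) = act g (w a h) \<otimes>\<^bsub>T\<^esub>
        (w g h \<otimes>\<^bsub>T\<^esub> act (h \<otimes>\<^bsub>G\<^esub> g) (w a b)) \<otimes>\<^bsub>T\<^esub> act h (w g b)"
      using car ab cl c
      by (subst w_mult_right) (simp_all add: w_mult_left act_mult act_act T.m_assoc)
    ultimately have "act (g \<otimes>\<^bsub>G\<^esub> h) (w a b) \<otimes>\<^bsub>T\<^esub> w g h
        = w g h \<otimes>\<^bsub>T\<^esub> act (h \<otimes>\<^bsub>G\<^esub> g) (w a b)"
      using car ab cl c by simp
    then show "act (g \<otimes>\<^bsub>G\<^esub> h) (w a b) = gconj T (w g h) (act (h \<otimes>\<^bsub>G\<^esub> g) (w a b))"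
      using car cl c by (simp add: gconj_def T.inv_solve_right)
  qed
  then show ?thesis using car c t by (simp add: T.word_simps)
qed

text \<open>The Peiffer identity on generators: apply \<open>act_mult_comm\<close> to the translate
  of \<open>t\<close> by the inverse of \<open>h \<otimes> g\<close>, and note that
  \<open>g \<otimes> h\<close> times that inverse is the commutator.\<close>

lemma gconj_w:
  assumes car: "g \<in> carrier G" "h \<in> carrier G" and t: "t \<in> carrier T"
  shows "gconj T (w g h) t = act (gcomm G g h) t"
proof -
  note c = w_closed[OF car]
  have "act (g \<otimes>\<^bsub>G\<^esub> h) (act (inv\<^bsub>G\<^esub> (h \<otimes>\<^bsub>G\<^esub> g)) t) \<otimes>\<^bsub>T\<^esub> w g h
      = w g h \<otimes>\<^bsub>T\<^esub> act (h \<otimes>\<^bsub>G\<^esub> g) (act (inv\<^bsub>G\<^esub> (h \<otimes>\<^bsub>G\<^esub> g)) t)"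
    by (rule act_mult_comm) (use car t in auto)
  then have "act (gcomm G g h) t \<otimes>\<^bsub>T\<^esub> w g h = w g h \<otimes>\<^bsub>T\<^esub> t"
    using car t by (simp add: act_act act_inv_cancel) (simp add: G.word_simps)
  then have "act (gcomm G g h) t = w g h \<otimes>\<^bsub>T\<^esub> t \<otimes>\<^bsub>T\<^esub> inv\<^bsub>T\<^esub> w g h"
    using car t c by (simp add: T.inv_solve_right)
  then show ?thesis by (simp add: gconj_def)
qed

text \<open>Both sides turn products in \<open>t\<close> into compositions, so the Peiffer identity
  passes from generators to all of \<open>T\<close>; thus \<open>bd\<close> is a crossed
  module.\<close>

lemma gconj_eq_act:
  assumes "t \<in> carrier T" "u \<in> carrier T"
  shows "gconj T t u = act (bd t) u"
  using assms
proof (induction arbitrary: u rule: T_induct)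
  case (w a b)
  then show ?case by (simp add: gconj_w bd_w)
next
  case (inv t)
  have "gconj T t (act (inv\<^bsub>G\<^esub> bd t) u) = u"
    using inv by (simp add: act_inv_cancel)
  then have "gconj T (inv\<^bsub>T\<^esub> t) u = gconj T (inv\<^bsub>T\<^esub> t) (gconj T t (act (inv\<^bsub>G\<^esub> bd t) u))"
    by simp
  also have "\<dots> = act (inv\<^bsub>G\<^esub> bd t) u" using inv(1,3) by (simp add: T.word_simps)
  finally show ?case using inv by simp
next
  case (mult t t')
  have "gconj T (t \<otimes>\<^bsub>T\<^esub> t') u = gconj T t (gconj T t' u)"
    using mult(1,2,5) by (simp add: T.word_simps)
  also have "\<dots> = act (bd (t \<otimes>\<^bsub>T\<^esub> t')) u" using mult by (simp add: act_act)
  finally show ?case .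
qed

text \<open>Write the commutator as \<open>u\<close> times the conjugate of \<open>inv u\<close> by
  \<open>v\<close>. Expand in the right entry, move the conjugation over to \<open>g\<close>, then
  expand in the left entry.\<close>

lemma w_gcomm:
  assumes g: "g \<in> carrier G" and u: "u \<in> carrier G" and v: "v \<in> carrier G"
  shows "w g (gcomm G u v) = act g (w u v) \<otimes>\<^bsub>T\<^esub> inv\<^bsub>T\<^esub> w u v"
proof -
  let ?v' = "inv\<^bsub>G\<^esub> v" and ?u' = "inv\<^bsub>G\<^esub> u"
  \<comment> \<open>Chosen so that \<open>act u s = w u v\<close>.\<close>
  define s where "s = w v ?u'"
  have s: "s \<in> carrier T" and gu: "w g u \<in> carrier T" and gu': "w g ?u' \<in> carrier T"
    and uv: "w u v \<in> carrier T" and v'u': "w ?v' ?u' \<in> carrier T"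
    using assms w_closed by (auto simp: s_def)
  have us: "act u s = w u v"
    using assms uv by (simp add: s_def w_inv_right w_swap[of u v])
  have "act v (w (gconj G ?v' g) ?u') = act v (w (?v' \<otimes>\<^bsub>G\<^esub> (g \<otimes>\<^bsub>G\<^esub> v)) ?u')"
    using assms by (simp add: gconj_def G.m_assoc)
  also have "\<dots> = act v (act ?v' (act g s \<otimes>\<^bsub>T\<^esub> w g ?u') \<otimes>\<^bsub>T\<^esub> w ?v' ?u')"
    using assms by (simp add: w_mult_left s_def)
  also have "\<dots> = act g s \<otimes>\<^bsub>T\<^esub> w g ?u' \<otimes>\<^bsub>T\<^esub> inv\<^bsub>T\<^esub> s"
    using assms s gu' v'u' by (simp add: act_mult act_inv_cancel w_inv_left s_def)
  finally have mid: "w g (gconj G v ?u') = act g s \<otimes>\<^bsub>T\<^esub> w g ?u' \<otimes>\<^bsub>T\<^esub> inv\<^bsub>T\<^esub> s"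
    using assms by (simp add: act_w) (simp add: G.word_simps)
  have "w g (gcomm G u v) = w g (u \<otimes>\<^bsub>G\<^esub> gconj G v ?u')"
    using assms by (simp add: G.word_simps)
  also have "\<dots> = w g u \<otimes>\<^bsub>T\<^esub> act u (act g s \<otimes>\<^bsub>T\<^esub> w g ?u' \<otimes>\<^bsub>T\<^esub> inv\<^bsub>T\<^esub> s)"
    using assms by (simp add: w_mult_right mid)
  also have "\<dots> = gconj T (w g u) (act (u \<otimes>\<^bsub>G\<^esub> g) s) \<otimes>\<^bsub>T\<^esub> inv\<^bsub>T\<^esub> w u v"
    using assms s gu gu' uv
    by (simp add: act_mult act_inv us w_inv_right act_act[of u g] gconj_def T.m_assoc)
  \<comment> \<open>Conjugation by \<open>w g u\<close> acts as the commutator of \<open>g\<close>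
    and \<open>u\<close>, which turns \<open>u \<otimes> g\<close> into
    \<open>g \<otimes> u\<close>.\<close>
  also have "gconj T (w g u) (act (u \<otimes>\<^bsub>G\<^esub> g) s) = act (g \<otimes>\<^bsub>G\<^esub> u) s"
    using assms s by (simp add: gconj_w act_act) (simp add: G.word_simps)
  also have "\<dots> = act g (w u v)"
    using assms s by (simp add: act_act[of g u s, symmetric] us)
  finally show ?thesis .
qed

text \<open>Extends \<open>w_gcomm\<close> to all boundaries. The twists by
  \<open>act (bd t)\<close> that arise for products and inverses are conjugations by the Peiffer
  identity, after which factors cancel. Displacements under the action thereby become
  wedges.\<close>

lemma w_bd:
  assumes t: "t \<in> carrier T" and g: "g \<in> carrier G"
  shows "w g (bd t) = act g t \<otimes>\<^bsub>T\<^esub> inv\<^bsub>T\<^esub> t"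
  using t
proof (induction rule: T_induct)
  case (w a b)
  then show ?case using g by (simp add: bd_w w_gcomm)
next
  case (inv t)
  have "act (bd t) (w g (inv\<^bsub>G\<^esub> bd t)) = inv\<^bsub>T\<^esub> (act g t \<otimes>\<^bsub>T\<^esub> inv\<^bsub>T\<^esub> t)"
    using inv g by (simp add: w_inv_right)
  then have "act (inv\<^bsub>G\<^esub> bd t) (act (bd t) (w g (inv\<^bsub>G\<^esub> bd t)))
      = act (bd (inv\<^bsub>T\<^esub> t)) (inv\<^bsub>T\<^esub> (act g t \<otimes>\<^bsub>T\<^esub> inv\<^bsub>T\<^esub> t))"
    using inv by simp
  then have "w g (inv\<^bsub>G\<^esub> bd t) = act (bd (inv\<^bsub>T\<^esub> t)) (inv\<^bsub>T\<^esub> (act g t \<otimes>\<^bsub>T\<^esub> inv\<^bsub>T\<^esub> t))"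
    using inv g w_closed by (simp add: act_inv_cancel)
  also have "\<dots> = gconj T (inv\<^bsub>T\<^esub> t) (inv\<^bsub>T\<^esub> (act g t \<otimes>\<^bsub>T\<^esub> inv\<^bsub>T\<^esub> t))"
    using inv(1) g by (intro gconj_eq_act[symmetric]) auto
  also have "\<dots> = act g (inv\<^bsub>T\<^esub> t) \<otimes>\<^bsub>T\<^esub> inv\<^bsub>T\<^esub> (inv\<^bsub>T\<^esub> t)"
    using inv(1) g by (simp add: T.word_simps act_inv)
  finally show ?case using inv by simp
next
  case (mult t u)
  have "w g (bd (t \<otimes>\<^bsub>T\<^esub> u)) = act g t \<otimes>\<^bsub>T\<^esub> inv\<^bsub>T\<^esub> t \<otimes>\<^bsub>T\<^esub>
      act (bd t) (act g u \<otimes>\<^bsub>T\<^esub> inv\<^bsub>T\<^esub> u)"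
    using mult g by (simp add: w_mult_right)
  also have "act (bd t) (act g u \<otimes>\<^bsub>T\<^esub> inv\<^bsub>T\<^esub> u) = gconj T t (act g u \<otimes>\<^bsub>T\<^esub> inv\<^bsub>T\<^esub> u)"
    using mult(1,2) g by (intro gconj_eq_act[symmetric]) auto
  also have "act g t \<otimes>\<^bsub>T\<^esub> inv\<^bsub>T\<^esub> t \<otimes>\<^bsub>T\<^esub> \<dots>
      = act g (t \<otimes>\<^bsub>T\<^esub> u) \<otimes>\<^bsub>T\<^esub> inv\<^bsub>T\<^esub> (t \<otimes>\<^bsub>T\<^esub> u)"
    using mult(1,2) g by (simp add: T.word_simps act_mult)
  finally show ?case .
qed

section \<open>The subgroups V n and the lower central series\<close>

definition V :: "nat \<Rightarrow> 't set" where
  "V n = generate T {w u v | u v. u \<in> lcs G n \<and> v \<in> carrier G}"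

lemma V_generators: "{w u v | u v. u \<in> lcs G n \<and> v \<in> carrier G} \<subseteq> carrier T"
  using w_closed G.lcs_carrier by blast

lemma V_subgroup: "subgroup (V n) T"
  unfolding V_def by (rule T.generate_is_subgroup[OF V_generators])

lemma V_carrier: "t \<in> V n \<Longrightarrow> t \<in> carrier T"
  by (rule subgroup.mem_carrier[OF V_subgroup])

lemmas V_one = subgroup.one_closed[OF V_subgroup]
  and V_mult = subgroup.m_closed[OF V_subgroup]
  and V_inv = subgroup.m_inv_closed[OF V_subgroup]

lemma V_0: "V 0 = carrier T"
  by (simp add: V_def carrier_T)

lemma w_in_V: "\<lbrakk>u \<in> lcs G n; v \<in> carrier G\<rbrakk> \<Longrightarrow> w u v \<in> V n"
  unfolding V_def by (auto intro: generate.incl)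

lemma w_swap_in_V: "\<lbrakk>u \<in> lcs G n; v \<in> carrier G\<rbrakk> \<Longrightarrow> w v u \<in> V n"
  using w_swap[of u v] V_inv[OF w_in_V] G.lcs_carrier by simp

lemma V_antimono: "m \<le> n \<Longrightarrow> V n \<subseteq> V m"
  unfolding V_def using G.lcs_antimono by (intro T.mono_generate) blast

lemma act_V:
  assumes g: "g \<in> carrier G" and t: "t \<in> V n"
  shows "act g t \<in> V n"
proof (rule T.hom_preserves_generate[OF act_hom[OF g] T.is_group V_generators V_subgroup])
  show "t \<in> generate T {w u v | u v. u \<in> lcs G n \<and> v \<in> carrier G}" using t V_def by simp
  fix a assume "a \<in> {w u v | u v. u \<in> lcs G n \<and> v \<in> carrier G}"
  then obtain u v where "a = w u v" "u \<in> lcs G n" "v \<in> carrier G" by blast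
  then show "act g a \<in> V n"
    using g by (simp add: act_w G.lcs_carrier w_in_V G.gconj_in_lcs)
qed

lemma bd_V:
  assumes t: "t \<in> V n"
  shows "bd t \<in> lcs G (Suc n)"
proof (rule T.hom_preserves_generate[OF bd_hom G.is_group V_generators G.lcs_subgroup])
  show "t \<in> generate T {w u v | u v. u \<in> lcs G n \<and> v \<in> carrier G}" using t V_def by simp
  fix a assume "a \<in> {w u v | u v. u \<in> lcs G n \<and> v \<in> carrier G}"
  then obtain u v where "a = w u v" "u \<in> lcs G n" "v \<in> carrier G" by blast
  then show "bd a \<in> lcs G (Suc n)"
    using G.gcomm_in_lcs_Suc by (simp add: bd_w G.lcs_carrier del: lcs.simps)
qed

lemma gconj_V: "\<lbrakk>t \<in> carrier T; u \<in> V n\<rbrakk> \<Longrightarrow> gconj T t u \<in> V n"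
  using act_V[of "bd t" u n] V_carrier by (simp add: gconj_eq_act)

text \<open>\<open>M\<close> has to be invariant under the action because the wedge is
  multiplicative in its right entry only up to a twist by \<open>act\<close>.\<close>

lemma w_generate_right:
  assumes M: "subgroup M T" and act_M: "\<And>g t. \<lbrakk>g \<in> carrier G; t \<in> M\<rbrakk> \<Longrightarrow> act g t \<in> M"
    and g: "g \<in> carrier G" and A: "A \<subseteq> carrier G" and wA: "\<And>a. a \<in> A \<Longrightarrow> w g a \<in> M"
    and h: "h \<in> generate G A"
  shows "w g h \<in> M"
  using h
proof (induction h rule: generate.induct)
  case one
  then show ?case using subgroup.one_closed[OF M] g by (simp add: w_one_right)
next
  case (inv h)
  then have hc: "h \<in> carrier G" using A by blast
  have "act (inv\<^bsub>G\<^esub> h) (act h (w g (inv\<^bsub>G\<^esub> h))) \<in> M"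
    using act_M[OF _ subgroup.m_inv_closed[OF M wA[OF inv]]] g hc by (simp add: w_inv_right)
  then show ?case using g hc by (simp add: act_inv_cancel w_closed)
next
  case (eng h k)
  then have "h \<in> carrier G" "k \<in> carrier G" using G.generate_in_carrier[OF A] by blast+
  then show ?case
    using subgroup.m_closed[OF M eng(3) act_M[OF _ eng(4)]] g by (simp add: w_mult_right)
qed (use wA in auto)

text \<open>A substitute for the three subgroups lemma. Modulo \<open>V (i + j + 1)\<close>, conjugating the wedge of
  \<open>u\<close> and \<open>v\<close> by \<open>g\<close> only multiplies it by the wedge of \<open>[g, v]\<close> and \<open>[u, v]\<close>, where \<open>[g, v]\<close>
  lies one step deeper in the lower central series than \<open>g\<close>; nilpotency ends this descent.\<close>

lemma w_in_V_add:
  assumes nil: "lcs G c = {\<one>\<^bsub>G\<^esub>}"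
  shows "\<lbrakk>g \<in> lcs G i; h \<in> lcs G j\<rbrakk> \<Longrightarrow> w g h \<in> V (i + j)"
proof (induction j arbitrary: i g h)
  case 0
  then show ?case using w_in_V by simp
next
  case (Suc j)
  \<comment> \<open>Inside the induction on \<open>j\<close>, a descending induction on
    \<open>i\<close> proves \<open>P i\<close>, starting where \<open>lcs G i\<close> is
    trivial.\<close>
  define P where "P i \<longleftrightarrow> (\<forall>g\<in>lcs G i. \<forall>h\<in>lcs G (Suc j). w g h \<in> V (i + Suc j))" for i
  have triv: "P i" if "c \<le> i" for i
    unfolding P_def
  proof (intro ballI)
    fix g h assume g: "g \<in> lcs G i" and h: "h \<in> lcs G (Suc j)"
    have "g = \<one>\<^bsub>G\<^esub>" using G.lcs_antimono[OF that] nil g by auto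
    then show "w g h \<in> V (i + Suc j)" using G.lcs_carrier[OF h] V_one by (simp add: w_one_left)
  qed
  have step: "P i" if PS: "P (Suc i)" for i
    unfolding P_def
  proof (intro ballI)
    fix g h assume gi: "g \<in> lcs G i" and h: "h \<in> lcs G (Suc j)"
    let ?M = "V (i + Suc j)"
    have g: "g \<in> carrier G" using G.lcs_carrier[OF gi] .
    show "w g h \<in> ?M"
    proof (rule w_generate_right[OF V_subgroup act_V g])
      show "h \<in> generate G {gcomm G x y | x y. x \<in> lcs G j \<and> y \<in> carrier G}"
        using h by simp
      show "{gcomm G x y | x y. x \<in> lcs G j \<and> y \<in> carrier G} \<subseteq> carrier G"
        using G.lcs_carrier by blast
      fix a assume "a \<in> {gcomm G x y | x y. x \<in> lcs G j \<and> y \<in> carrier G}"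
      then obtain u v where a: "a = gcomm G u v" and uj: "u \<in> lcs G j" and v: "v \<in> carrier G"
        by blast
      have u: "u \<in> carrier G" using G.lcs_carrier[OF uj] .
      define k where "k = gcomm G g u"
      define d where "d = gcomm G g v"
      \<comment> \<open>The induction hypothesis for \<open>j\<close> puts \<open>w g u\<close> into
        \<open>V (i + j)\<close>, and the boundary of this wedge is \<open>k\<close>.\<close>
      have k: "k \<in> lcs G (i + Suc j)"
        using bd_V[OF Suc.IH[OF gi uj]] g u by (simp add: bd_w k_def del: lcs.simps)
      have d: "d \<in> lcs G (Suc i)" using G.gcomm_in_lcs_Suc[OF gi v] by (simp add: d_def)
      note kc = G.lcs_carrier[OF k] and dc = G.lcs_carrier[OF d]
      define t where "t = w u v"
      define y where "y = w u (d \<otimes>\<^bsub>G\<^esub> v)"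
      have tc: "t \<in> carrier T" and yc: "y \<in> carrier T" and udc: "w u d \<in> carrier T"
        and kvc: "w k (d \<otimes>\<^bsub>G\<^esub> v) \<in> carrier T"
        using u v dc kc w_closed by (auto simp: t_def y_def)
      \<comment> \<open>By \<open>w_bd\<close> this displacement is the wedge of \<open>k\<close>
        with \<open>bd y\<close>.\<close>
      have m1: "act k y \<otimes>\<^bsub>T\<^esub> inv\<^bsub>T\<^esub> y \<in> ?M"
        using w_bd[OF yc kc] w_in_V[OF k, of "bd y"] yc by simp
      have m2: "w k (d \<otimes>\<^bsub>G\<^esub> v) \<in> ?M" using w_in_V[OF k] dc v by simp
      have "w d u \<in> ?M" using Suc.IH[OF d uj] by simp
      then have m3: "w u d \<in> ?M" using w_swap[OF dc u] V_inv by simp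
      have "gcomm G u v \<in> lcs G (Suc j)" by (rule G.gcomm_in_lcs_Suc[OF uj v])
      \<comment> \<open>The descending hypothesis enters here, through \<open>d\<close>.\<close>
      then have "w d (gcomm G u v) \<in> V (Suc i + Suc j)" using PS d unfolding P_def by blast
      then have m4: "act d t \<otimes>\<^bsub>T\<^esub> inv\<^bsub>T\<^esub> t \<in> ?M"
        using w_gcomm[OF dc u v] V_antimono[of "i + Suc j" "Suc i + Suc j"] by (auto simp: t_def)
      have y: "y = w u d \<otimes>\<^bsub>T\<^esub> act d t"
        using u v dc by (simp add: y_def t_def w_mult_right)
      have m5: "y \<otimes>\<^bsub>T\<^esub> inv\<^bsub>T\<^esub> t \<in> ?M"
        using V_mult[OF m3 m4] udc dc tc by (simp add: y T.m_assoc)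
      have "act g t = w (k \<otimes>\<^bsub>G\<^esub> u) (d \<otimes>\<^bsub>G\<^esub> v)"
        using g u v by (simp add: t_def act_w k_def d_def G.gconj_eq_gcomm_mult)
      also have "\<dots> = act k y \<otimes>\<^bsub>T\<^esub> w k (d \<otimes>\<^bsub>G\<^esub> v)"
        using kc u dc v by (simp add: w_mult_left y_def)
      finally have "w g a = act k y \<otimes>\<^bsub>T\<^esub> w k (d \<otimes>\<^bsub>G\<^esub> v) \<otimes>\<^bsub>T\<^esub> inv\<^bsub>T\<^esub> t"
        using w_gcomm[OF g u v] by (simp add: a t_def)
      \<comment> \<open>Inserting \<open>y\<close> and its inverse twice isolates \<open>m1\<close>,
        a conjugate of \<open>m2\<close>, and \<open>m5\<close>.\<close>
      also have "\<dots> = (act k y \<otimes>\<^bsub>T\<^esub> inv\<^bsub>T\<^esub> y) \<otimes>\<^bsub>T\<^esub> gconj T y (w k (d \<otimes>\<^bsub>G\<^esub> v))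
          \<otimes>\<^bsub>T\<^esub> (y \<otimes>\<^bsub>T\<^esub> inv\<^bsub>T\<^esub> t)"
        using kc yc kvc tc by (simp add: T.word_simps)
      also have "\<dots> \<in> ?M"
        by (intro V_mult m1 m5 gconj_V yc m2)
      finally show "w g a \<in> ?M" .
    qed
  qed
  have "P i"
  proof (cases "i \<le> c")
    case True
    then show ?thesis by (induction rule: inc_induct) (use triv step in auto)
  qed (use triv in simp)
  then show ?case using Suc.prems unfolding P_def by blast
qed

section \<open>Commutators and powers in the semidirect product\<close>

abbreviation "K \<equiv> semidirect T G act"

lemma group_semidirect: "group K"
proof (rule groupI)
  fix x y z assume "x \<in> carrier K" "y \<in> carrier K" "z \<in> carrier K"
  then show "x \<otimes>\<^bsub>K\<^esub> y \<otimes>\<^bsub>K\<^esub> z = x \<otimes>\<^bsub>K\<^esub> (y \<otimes>\<^bsub>K\<^esub> z)"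
    by (cases x; cases y; cases z) (auto simp: T.m_assoc G.m_assoc act_mult act_act)
next
  fix x assume "x \<in> carrier K"
  then obtain t g where x: "x = (t, g)" "t \<in> carrier T" "g \<in> carrier G" by auto
  then show "\<exists>y\<in>carrier K. y \<otimes>\<^bsub>K\<^esub> x = \<one>\<^bsub>K\<^esub>"
    by (intro bexI[of _ "(inv\<^bsub>T\<^esub> act (inv\<^bsub>G\<^esub> g) t, inv\<^bsub>G\<^esub> g)"]) auto
qed auto

definition level :: "nat \<Rightarrow> ('t \<times> 'a) set" where
  "level n = V n \<times> lcs G n"

lemma level_antimono: "m \<le> n \<Longrightarrow> level n \<subseteq> level m"
  unfolding level_def using V_antimono G.lcs_antimono by (intro Sigma_mono) auto

lemma level_subgroup: "subgroup (level n) K"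
proof (rule group.subgroupI[OF group_semidirect])
  show "level n \<subseteq> carrier K" using V_carrier G.lcs_carrier by (auto simp: level_def)
  show "level n \<noteq> {}"
    using V_one subgroup.one_closed[OF G.lcs_subgroup] unfolding level_def by blast
next
  fix x assume "x \<in> level n"
  then obtain t g where x: "x = (t, g)" "t \<in> V n" "g \<in> lcs G n" by (auto simp: level_def)
  note c = V_carrier[OF x(2)] G.lcs_carrier[OF x(3)]
  have "inv\<^bsub>K\<^esub> x = (inv\<^bsub>T\<^esub> act (inv\<^bsub>G\<^esub> g) t, inv\<^bsub>G\<^esub> g)"
    by (rule group.inv_equality[OF group_semidirect]) (use x c in auto)
  then show "inv\<^bsub>K\<^esub> x \<in> level n"
    using x c V_inv[OF act_V] subgroup.m_inv_closed[OF G.lcs_subgroup] by (simp add: level_def)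
next
  fix x y assume "x \<in> level n" "y \<in> level n"
  then show "x \<otimes>\<^bsub>K\<^esub> y \<in> level n"
    using V_mult act_V subgroup.m_closed[OF G.lcs_subgroup] G.lcs_carrier
    by (auto simp: level_def)
qed

text \<open>The second component is the boundary of \<open>w g h\<close>. The first is assembled
  from displacements, which \<open>w_bd\<close> turns into wedges and \<open>w_in_V_add\<close>
  bounds. The gain of one in the index comes from \<open>bd_V\<close>.\<close>

lemma level_gcomm:
  assumes nil: "lcs G c = {\<one>\<^bsub>G\<^esub>}" and x: "x \<in> level m" and y: "y \<in> level n"
  shows "gcomm K x y \<in> level (Suc (m + n))"
proof -
  interpret K: group K by (rule group_semidirect)
  let ?M = "V (Suc (m + n))"
  obtain t g u h where xy: "x = (t, g)" "y = (u, h)"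
    and t: "t \<in> V m" and g: "g \<in> lcs G m" and u: "u \<in> V n" and h: "h \<in> lcs G n"
    using x y by (auto simp: level_def)
  note c = V_carrier[OF t] G.lcs_carrier[OF g] V_carrier[OF u] G.lcs_carrier[OF h]
  define k where "k = gcomm G g h"
  have kL: "k \<in> lcs G (Suc (m + n))"
    using bd_V[OF w_in_V_add[OF nil g h]] c by (simp add: bd_w k_def del: lcs.simps)
  note kc = G.lcs_carrier[OF kL]
  define d1 where "d1 = act g u \<otimes>\<^bsub>T\<^esub> inv\<^bsub>T\<^esub> u"
  define d2 where "d2 = act h t \<otimes>\<^bsub>T\<^esub> inv\<^bsub>T\<^esub> t"
  define b where "b = u \<otimes>\<^bsub>T\<^esub> act h t"
  define e where "e = act k b \<otimes>\<^bsub>T\<^esub> inv\<^bsub>T\<^esub> b"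
  have bc: "b \<in> carrier T" using c by (simp add: b_def)
  have d1: "d1 \<in> ?M" using w_in_V_add[OF nil g bd_V[OF u]] c by (simp add: d1_def w_bd)
  have d2: "d2 \<in> ?M"
    using w_in_V_add[OF nil h bd_V[OF t]] c by (simp add: d2_def w_bd add.commute)
  have e: "e \<in> ?M" using w_in_V[OF kL, of "bd b"] bc kc by (simp add: e_def w_bd)
  \<comment> \<open>The wedge of the two boundaries is the commutator of \<open>t\<close> and
    \<open>u\<close>; it lies even one step deeper than required.\<close>
  have "w (bd t) (bd u) \<in> V (Suc m + Suc n)" by (rule w_in_V_add[OF nil bd_V[OF t] bd_V[OF u]])
  also have "\<dots> \<subseteq> ?M" by (rule V_antimono) simp
  finally have tu: "gcomm T t u \<in> ?M"
    using c by (simp add: w_bd gconj_eq_act[symmetric]) (simp add: T.word_simps)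
  note dc = V_carrier[OF d1] V_carrier[OF d2] V_carrier[OF e]
  \<comment> \<open>The commutator is the solution \<open>z\<close> of \<open>z y x = x y\<close>;
    comparing first components gives this value.\<close>
  define a where "a = t \<otimes>\<^bsub>T\<^esub> act g u \<otimes>\<^bsub>T\<^esub> inv\<^bsub>T\<^esub> act k b"
  have ac: "a \<in> carrier T" using c bc kc by (simp add: a_def)
  have "act g u = d1 \<otimes>\<^bsub>T\<^esub> u" "act h t = d2 \<otimes>\<^bsub>T\<^esub> t" "act k b = e \<otimes>\<^bsub>T\<^esub> b"
    using c bc kc by (simp_all add: d1_def d2_def e_def T.m_assoc)
  then have "a = gconj T t d1 \<otimes>\<^bsub>T\<^esub> gcomm T t u \<otimes>\<^bsub>T\<^esub> gconj T u (inv\<^bsub>T\<^esub> d2) \<otimes>\<^bsub>T\<^esub> inv\<^bsub>T\<^esub> e"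
    using c dc by (simp add: a_def b_def T.word_simps)
  also have "\<dots> \<in> ?M"
    using c by (intro V_mult V_inv gconj_V d1 d2 e tu)
  finally have aM: "a \<in> ?M" .
  have cK: "x \<in> carrier K" "y \<in> carrier K" "(a, k) \<in> carrier K" using xy c ac kc by auto
  have "(a, k) \<otimes>\<^bsub>K\<^esub> (y \<otimes>\<^bsub>K\<^esub> x) = x \<otimes>\<^bsub>K\<^esub> y"
    using xy c kc bc by (simp add: a_def b_def[symmetric] T.m_assoc) (simp add: k_def G.word_simps)
  also have "\<dots> = gcomm K x y \<otimes>\<^bsub>K\<^esub> (y \<otimes>\<^bsub>K\<^esub> x)"
    using cK by (simp add: K.word_simps del: semidirect_simps)
  finally have "(a, k) = gcomm K x y"
    using cK K.r_cancel K.gcomm_closed K.m_closed by (metis (no_types, lifting))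
  then show ?thesis using aM kL by (metis level_def mem_Sigma_iff)
qed

text \<open>For positive indices the extra one in \<open>level_gcomm\<close> offsets one of the two
  subtractions, leaving exactly \<open>(i + j) r - 1\<close>. At index 0 truncated subtraction gives
  \<open>level 0\<close>, the whole group.\<close>

lemma level_filtration:
  assumes nil: "lcs G c = {\<one>\<^bsub>G\<^esub>}"
  shows "filtration K (\<lambda>k. level (k * r - 1))"
  unfolding filtration_def
proof (intro conjI allI ballI)
  show "subgroup (level (i * r - 1)) K" for i by (rule level_subgroup)
  show "level (Suc i * r - 1) \<subseteq> level (i * r - 1)" for i by (rule level_antimono) simp
next
  fix i j x y assume "x \<in> level (i * r - 1)" "y \<in> level (j * r - 1)"
  from level_gcomm[OF nil this]
  have "gcomm K x y \<in> level (Suc (i * r - 1 + (j * r - 1)))" .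
  moreover have "(i + j) * r - 1 \<le> Suc (i * r - 1 + (j * r - 1))"
    by (simp add: add_mult_distrib)
  ultimately show "gcomm K x y \<in> level ((i + j) * r - 1)" using level_antimono by blast
qed

text \<open>By \<open>w_mult_right\<close>, the map sending \<open>a\<close> to
  \<open>(w b a, a)\<close> is a homomorphism from \<open>G\<close> to \<open>K\<close>.\<close>

lemma semidirect_pow:
  assumes "a \<in> carrier G" "b \<in> carrier G"
  shows "(w b a, a) [^]\<^bsub>K\<^esub> (n::nat) = (w b (a [^]\<^bsub>G\<^esub> n), a [^]\<^bsub>G\<^esub> n)"
proof -
  interpret K: group K by (rule group_semidirect)
  show ?thesis using assms by (induction n) (simp_all add: w_one_right w_mult_right)
qed

lemma semidirect_pow_T:
  assumes "t \<in> carrier T"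
  shows "(t, \<one>\<^bsub>G\<^esub>) [^]\<^bsub>K\<^esub> (n::nat) = (t [^]\<^bsub>T\<^esub> n, \<one>\<^bsub>G\<^esub>)"
proof -
  interpret K: group K by (rule group_semidirect)
  show ?thesis using assms by (induction n) simp_all
qed

text \<open>In the semidirect product, \<open>(w v u, u)\<close> is a twisted conjugate of \<open>(\<one>, u)\<close>, so both have
  trivial \<open>q\<close>-th power, and their quotient is the wedge itself.\<close>

lemma pow_exponent_V:
  assumes nil: "lcs G c = {\<one>\<^bsub>G\<^esub>}" and p: "2 \<le> p" and r: "1 \<le> r"
    and dv: "\<And>i. \<lbrakk>0 < i; i < p\<rbrakk> \<Longrightarrow> q dvd (q choose i)"
    and q: "\<And>x. x \<in> carrier G \<Longrightarrow> x [^]\<^bsub>G\<^esub> (q::nat) = \<one>\<^bsub>G\<^esub>"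
    and t: "t \<in> V (r - 1)"
  shows "t [^]\<^bsub>T\<^esub> q \<in> V (p * r - 1)"
proof -
  interpret K: filtered_group K "\<lambda>k. level (k * r - 1)"
    by (intro filtered_group.intro group_semidirect filtered_group_axioms.intro
        level_filtration[OF nil])
  have full: "level (0 * r - 1) = carrier K" by (simp add: level_def V_0)
  \<comment> \<open>\<open>mult_torsion_mod\<close> for the sampled filtration, whose term at
    \<open>p\<close> is \<open>level (p r - 1)\<close>, closes \<open>S\<close> under
    products.\<close>
  define S where "S = {x \<in> level (1 * r - 1). x [^]\<^bsub>K\<^esub> q \<in> level (p * r - 1)}"
  have S_mult: "x \<otimes>\<^bsub>K\<^esub> y \<in> S" if "x \<in> S" "y \<in> S" for x y
    using that K.mult_torsion_mod[OF dv p full, of x y] K.F_mult[of x 1 y]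
    by (simp add: S_def del: semidirect_simps)
  have S_T: "(t, \<one>\<^bsub>G\<^esub>) \<in> S \<longleftrightarrow> t \<in> V (r - 1) \<and> t [^]\<^bsub>T\<^esub> q \<in> V (p * r - 1)" for t
    using subgroup.one_closed[OF G.lcs_subgroup] V_carrier
    by (auto simp: S_def level_def semidirect_pow_T)
  have wS: "(w v u, \<one>\<^bsub>G\<^esub>) \<in> S"
    if u: "u \<in> lcs G (r - 1)" and v: "v \<in> carrier G" for u v
  proof -
    note uc = G.lcs_carrier[OF u]
    have iu: "inv\<^bsub>G\<^esub> u \<in> lcs G (r - 1)" using u subgroup.m_inv_closed[OF G.lcs_subgroup] by blast
    have one: "\<one>\<^bsub>K\<^esub> \<in> level (p * r - 1)" by (rule K.F_one)
    have "(w v u, u) \<in> S"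
      using u v one w_swap_in_V uc
      by (simp add: S_def level_def semidirect_pow q w_one_right)
    moreover have "(\<one>\<^bsub>T\<^esub>, inv\<^bsub>G\<^esub> u) \<in> S"
      using iu one uc semidirect_pow[of "inv\<^bsub>G\<^esub> u" "\<one>\<^bsub>G\<^esub>" q] V_one
      by (simp add: S_def level_def q w_one_left w_one_right)
    ultimately have "(w v u, u) \<otimes>\<^bsub>K\<^esub> (\<one>\<^bsub>T\<^esub>, inv\<^bsub>G\<^esub> u) \<in> S" by (rule S_mult)
    then show ?thesis using uc w_closed[OF v uc] by simp
  qed
  have "(t, \<one>\<^bsub>G\<^esub>) \<in> S"
    using t unfolding V_def
  proof (induction t rule: generate.induct)
    case one
    then show ?case using V_one by (simp add: S_T)
  next
    case (incl t)
    then obtain u v where uv: "t = w u v" "u \<in> lcs G (r - 1)" "v \<in> carrier G" by blast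
    \<comment> \<open>\<open>wS\<close> concerns \<open>w v u\<close>, the inverse of the generator
      \<open>t\<close>; inversion commutes with the power.\<close>
    then have "w v u \<in> V (r - 1)" "w v u [^]\<^bsub>T\<^esub> q \<in> V (p * r - 1)"
      using wS[of u v] w_closed G.lcs_carrier by (auto simp: S_T)
    then show ?case
      using V_inv[of "w v u"] V_inv[of "w v u [^]\<^bsub>T\<^esub> q"] w_swap[of v u] uv
        w_closed[of v u] G.lcs_carrier[of u]
      by (simp add: S_T T.nat_pow_inv)
  next
    case (inv t)
    then obtain u v where uv: "t = w u v" "u \<in> lcs G (r - 1)" "v \<in> carrier G" by blast
    then show ?case
      using wS[of u v] w_swap[of u v] w_closed G.lcs_carrier by auto
  next
    case (eng t u)
    then show ?case
      using S_mult[OF eng(3,4)] V_carrier[of u "r - 1"] by (simp add: S_T V_def)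
  qed
  then show ?thesis by (simp add: S_T)
qed

text \<open>Iterate \<open>pow_exponent_V\<close> with \<open>r = p ^ n\<close>, starting from
  \<open>V 0\<close>, which is all of \<open>T\<close>.\<close>

lemma pow_exponent_power_V:
  assumes nil: "lcs G c = {\<one>\<^bsub>G\<^esub>}" and p: "2 \<le> p"
    and dv: "\<And>i. \<lbrakk>0 < i; i < p\<rbrakk> \<Longrightarrow> q dvd (q choose i)"
    and q: "\<And>x. x \<in> carrier G \<Longrightarrow> x [^]\<^bsub>G\<^esub> (q::nat) = \<one>\<^bsub>G\<^esub>"
    and t: "t \<in> carrier T"
  shows "t [^]\<^bsub>T\<^esub> (q ^ n) \<in> V (p ^ n - 1)"
proof (induction n)
  case 0
  then show ?case using t by (simp add: V_0)
next
  case (Suc n)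
  have "1 \<le> p ^ n" using p by simp
  from pow_exponent_V[OF nil p this dv q Suc]
  show ?case using t by (simp add: T.nat_pow_pow mult.commute)
qed

lemma V_trivial:
  assumes nil: "lcs G c = {\<one>\<^bsub>G\<^esub>}"
  shows "V c = {\<one>\<^bsub>T\<^esub>}"
proof -
  have "{w u v | u v. u \<in> lcs G c \<and> v \<in> carrier G} \<subseteq> {\<one>\<^bsub>T\<^esub>}"
    using nil by (auto simp: w_one_left)
  then have "V c \<subseteq> {\<one>\<^bsub>T\<^esub>}"
    unfolding V_def by (rule T.generate_subgroup_incl[OF _ T.triv_subgroup])
  then show ?thesis using V_one by blast
qed

end

section \<open>Exponents\<close>

lemma ext_relations_cases [consumes 1, case_names left right self]:
  assumes "(u, v) \<in> ext_relations G"
  obtains (left) g g' h where "g \<in> carrier G" "g' \<in> carrier G" "h \<in> carrier G"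
      "u = [((g \<otimes>\<^bsub>G\<^esub> g', h), True)]"
      "v = [((gconj G g g', gconj G g h), True), ((g, h), True)]"
    | (right) g h h' where "g \<in> carrier G" "h \<in> carrier G" "h' \<in> carrier G"
      "u = [((g, h \<otimes>\<^bsub>G\<^esub> h'), True)]"
      "v = [((g, h), True), ((gconj G h g, gconj G h h'), True)]"
    | (self) x where "x \<in> carrier G" "u = [((x, x), True)]" "v = []"
  using assms unfolding ext_relations_def by blast

definition wedge :: "('a, 'b) monoid_scheme \<Rightarrow> 'a \<Rightarrow> 'a \<Rightarrow> ('a \<times> 'a) word set" where
  "wedge G a b = pres_gen (carrier G \<times> carrier G) (ext_relations G) (a, b)"

lemma wedge_relations:
  assumes "a \<in> carrier G" "b \<in> carrier G" "c \<in> carrier G"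
  shows "wedge G (a \<otimes>\<^bsub>G\<^esub> b) c
      = wedge G (gconj G a b) (gconj G a c) \<otimes>\<^bsub>ext_square G\<^esub> wedge G a c"
    and "wedge G a (b \<otimes>\<^bsub>G\<^esub> c)
      = wedge G a b \<otimes>\<^bsub>ext_square G\<^esub> wedge G (gconj G b a) (gconj G b c)"
    and "wedge G a a = \<one>\<^bsub>ext_square G\<^esub>"
  unfolding wedge_def ext_square_def presented_group_mult presented_group_one pres_class_eq_iff
  by (rule pres_eq.rel; use assms in \<open>simp add: ext_relations_def; blast\<close>)+

context group
begin

lemma group_ext_square: "group (ext_square G)"
  by (simp add: ext_square_def group_presented_group)

lemma ext_square_generate:
  "carrier (ext_square G)
    = generate (ext_square G) {wedge G a b | a b. a \<in> carrier G \<and> b \<in> carrier G}"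
proof -
  have "{wedge G a b | a b. a \<in> carrier G \<and> b \<in> carrier G}
      = pres_gen (carrier G \<times> carrier G) (ext_relations G) ` (carrier G \<times> carrier G)"
    by (auto simp: wedge_def)
  then show ?thesis by (simp only: ext_square_def presented_group_generate)
qed

lemma wedge_closed:
  "\<lbrakk>a \<in> carrier G; b \<in> carrier G\<rbrakk> \<Longrightarrow> wedge G a b \<in> carrier (ext_square G)"
  by (simp add: wedge_def ext_square_def pres_class_in_carrier)

lemma ext_square_universal:
  assumes H: "group H"
    and f: "\<And>a b. \<lbrakk>a \<in> carrier G; b \<in> carrier G\<rbrakk> \<Longrightarrow> f a b \<in> carrier H"
    and left: "\<And>a b c. \<lbrakk>a \<in> carrier G; b \<in> carrier G; c \<in> carrier G\<rbrakk>
      \<Longrightarrow> f (a \<otimes> b) c = f (gconj G a b) (gconj G a c) \<otimes>\<^bsub>H\<^esub> f a c"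
    and right: "\<And>a b c. \<lbrakk>a \<in> carrier G; b \<in> carrier G; c \<in> carrier G\<rbrakk>
      \<Longrightarrow> f a (b \<otimes> c) = f a b \<otimes>\<^bsub>H\<^esub> f (gconj G b a) (gconj G b c)"
    and self: "\<And>a. a \<in> carrier G \<Longrightarrow> f a a = \<one>\<^bsub>H\<^esub>"
  shows "\<exists>\<phi>\<in>hom (ext_square G) H. \<forall>a\<in>carrier G. \<forall>b\<in>carrier G. \<phi> (wedge G a b) = f a b"
proof -
  interpret H: group H by (rule H)
  define F where "F x = f (fst x) (snd x)" for x
  have "\<exists>\<phi>\<in>hom (presented_group (carrier G \<times> carrier G) (ext_relations G)) H.
      \<forall>x\<in>carrier G \<times> carrier G.
        \<phi> (pres_gen (carrier G \<times> carrier G) (ext_relations G) x) = F x"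
  proof (rule H.presented_group_universal)
    show "F \<in> carrier G \<times> carrier G \<rightarrow> carrier H" using f by (auto simp: F_def)
  next
    fix u v assume "(u, v) \<in> ext_relations G"
    then show "word_over (carrier G \<times> carrier G) u \<and> word_over (carrier G \<times> carrier G) v \<and>
        word_eval H F u = word_eval H F v"
    proof (cases rule: ext_relations_cases)
      case (left g g' h)
      then show ?thesis using assms(3)[of g g' h] f by (simp add: F_def)
    next
      case (right g h h')
      then show ?thesis using assms(4)[of g h h'] f by (simp add: F_def)
    next
      case (self x)
      then show ?thesis using assms(5)[of x] f by (simp add: F_def)
    qed
  qed
  then obtain \<phi> where "\<phi> \<in> hom (ext_square G) H"
    "\<forall>x\<in>carrier G \<times> carrier G.
      \<phi> (pres_gen (carrier G \<times> carrier G) (ext_relations G) x) = F x"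
    unfolding ext_square_def by blast
  then show ?thesis by (intro bexI[of _ \<phi>]) (auto simp: wedge_def F_def)
qed

text \<open>Action and boundary come from the universal property: conjugating both entries preserves
  the defining relations, and commutators in \<open>G\<close> satisfy them.\<close>

lemma exists_exterior_pairing:
  "\<exists>act bd. exterior_pairing G (ext_square G) (wedge G) act bd"
proof -
  let ?T = "ext_square G"
  interpret T: group ?T by (rule group_ext_square)
  have cj: "gconj G g (a \<otimes> b) = gconj G g a \<otimes> gconj G g b"
    "gconj G g (gconj G a b) = gconj G (gconj G g a) (gconj G g b)"
    if "g \<in> carrier G" "a \<in> carrier G" "b \<in> carrier G" for g a b
    using that by (simp_all add: word_simps)
  have "\<exists>\<phi>\<in>hom ?T ?T. \<forall>a\<in>carrier G. \<forall>b\<in>carrier G.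
      \<phi> (wedge G a b) = wedge G (gconj G g a) (gconj G g b)" if "g \<in> carrier G" for g
  proof (rule ext_square_universal[OF group_ext_square])
    fix a b c assume abc: "a \<in> carrier G" "b \<in> carrier G" "c \<in> carrier G"
    show "wedge G (gconj G g (a \<otimes> b)) (gconj G g c)
        = wedge G (gconj G g (gconj G a b)) (gconj G g (gconj G a c))
          \<otimes>\<^bsub>?T\<^esub> wedge G (gconj G g a) (gconj G g c)"
      unfolding cj(1)[OF that abc(1,2)] cj(2)[OF that abc(1,2)] cj(2)[OF that abc(1,3)]
      by (rule wedge_relations) (use that abc in auto)
    show "wedge G (gconj G g a) (gconj G g (b \<otimes> c))
        = wedge G (gconj G g a) (gconj G g b)
          \<otimes>\<^bsub>?T\<^esub> wedge G (gconj G g (gconj G b a)) (gconj G g (gconj G b c))"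
      unfolding cj(1)[OF that abc(2,3)] cj(2)[OF that abc(2,1)] cj(2)[OF that abc(2,3)]
      by (rule wedge_relations) (use that abc in auto)
  qed (use that in \<open>auto simp: wedge_closed wedge_relations\<close>)
  then obtain act where act: "\<And>g. g \<in> carrier G \<Longrightarrow> act g \<in> hom ?T ?T \<and>
      (\<forall>a\<in>carrier G. \<forall>b\<in>carrier G. act g (wedge G a b) = wedge G (gconj G g a) (gconj G g b))"
    by metis
  have "\<exists>\<phi>\<in>hom ?T G. \<forall>a\<in>carrier G. \<forall>b\<in>carrier G. \<phi> (wedge G a b) = gcomm G a b"
    by (rule ext_square_universal[OF is_group]) (simp_all add: word_simps)
  then obtain bd where bd: "bd \<in> hom ?T G"
    "\<And>a b. \<lbrakk>a \<in> carrier G; b \<in> carrier G\<rbrakk> \<Longrightarrow> bd (wedge G a b) = gcomm G a b"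
    by blast
  have "exterior_pairing G ?T (wedge G) act bd"
  proof (unfold_locales, goal_cases)
    \<comment> \<open>Goals 2 to 5 are generation and the three families of relations.\<close>
    case 2
    show ?case by (rule ext_square_generate)
  next
    case (3 a a' b)
    then show ?case by (rule wedge_relations(1))
  next
    case (4 a b b')
    then show ?case by (rule wedge_relations(2))
  next
    case (5 a)
    from wedge_relations(3)[OF this this this] show ?case .
  qed (use act bd wedge_closed in blast)+
  then show ?thesis by blast
qed

text \<open>\<open>ord x\<close> divides every annihilating exponent, hence also their gcd.\<close>

lemma pow_group_exponent:
  assumes "x \<in> carrier G"
  shows "x [^] group_exponent G = \<one>"
proof -
  have "ord x dvd group_exponent G"
    unfolding group_exponent_def by (rule Gcd_greatest) (use assms in \<open>auto simp: pow_eq_id\<close>)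
  then show ?thesis using assms by (simp add: pow_eq_id)
qed

lemma group_exponent_p_group:
  assumes p: "Factorial_Ring.prime p" and "p_group p G"
  shows "\<exists>e. group_exponent G = p ^ e"
proof -
  obtain k where k: "order G = p ^ k" using assms(2) unfolding p_group_def by blast
  have "group_exponent G dvd order G"
    unfolding group_exponent_def by (rule Gcd_dvd) (simp add: pow_order_eq_1)
  then show ?thesis using divides_primepow_nat[OF p] k by auto
qed

end

section \<open>Divisibility, the logarithm bound and the conclusion\<close>

lemma group_exponent_dvdI:
  "(\<And>x. x \<in> carrier G \<Longrightarrow> x [^]\<^bsub>G\<^esub> n = \<one>\<^bsub>G\<^esub>) \<Longrightarrow> group_exponent G dvd n"
  unfolding group_exponent_def by (rule Gcd_dvd) simp

text \<open>\<open>p ^ e\<close> divides \<open>i\<close> times the binomial coefficient by the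
  absorption identity, and \<open>i < p\<close> is coprime to \<open>p\<close>.\<close>

lemma prime_power_dvd_choose:
  fixes p :: nat
  assumes p: "Factorial_Ring.prime p" and i: "0 < i" "i < p"
  shows "p ^ e dvd (p ^ e choose i)"
proof -
  have "i * (p ^ e choose i) = p ^ e * ((p ^ e - 1) choose (i - 1))"
    using times_binomial_minus1_eq[OF i(1), of "p ^ e"] by simp
  then have "p ^ e dvd i * (p ^ e choose i)" by simp
  moreover have "coprime (p ^ e) i"
    using prime_imp_coprime[OF p, of i] nat_dvd_not_less[OF i] by simp
  ultimately show ?thesis by (simp add: coprime_dvd_mult_right_iff)
qed

text \<open>The ceiling gives \<open>c \<le> (p - 1) ^ n\<close>, and passing from base
  \<open>p - 1\<close> to base \<open>p\<close> makes this strict, which absorbs the subtracted 1.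
  Strictness requires \<open>0 < n\<close>; for \<open>c = 1\<close> the logarithm is 0 and the
  bound fails.\<close>

lemma class_le_prime_power:
  assumes p: "3 \<le> p" and c: "c \<noteq> 1"
  shows "c \<le> p ^ nat \<lceil>log (real (p - 1)) (real c)\<rceil> - 1"
proof (cases "c = 0")
  case False
  define n where "n = nat \<lceil>log (real (p - 1)) (real c)\<rceil>"
  have c2: "2 \<le> c" using c False by simp
  have b: "1 < real (p - 1)" using p by simp
  have pos: "0 < log (real (p - 1)) (real c)" using b c2 by simp
  have "log (real (p - 1)) (real c) \<le> real n"
    unfolding n_def by (rule real_nat_ceiling_ge)
  then have "real c \<le> real (p - 1) powr real n" using b c2 by (simp add: log_le_iff)
  also have "\<dots> = real ((p - 1) ^ n)" using b by (simp add: powr_realpow)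
  finally have "c \<le> (p - 1) ^ n" by (simp only: of_nat_le_iff)
  also have "(p - 1) ^ n < p ^ n"
  proof (rule power_strict_mono)
    show "0 < n" using pos unfolding n_def by linarith
  qed (use p in auto)
  finally show ?thesis by (simp add: n_def)
qed simp

theorem theorem5p6:
  fixes G :: "('a, 'b) monoid_scheme" and p c :: nat
  assumes "group G" and "Factorial_Ring.prime p" and "odd p" and "p_group p G"
    and "nilpotency_class G c" and "c \<noteq> 1"
  shows "group_exponent (ext_square G) dvd
           group_exponent G ^ nat \<lceil>log (real (p - 1)) (real c)\<rceil>
       \<and> group_exponent (schur_mult G) dvd
           group_exponent G ^ nat \<lceil>log (real (p - 1)) (real c)\<rceil>"
proof -
  interpret group G by (rule assms)
  define n where "n = nat \<lceil>log (real (p - 1)) (real c)\<rceil>"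
  define q where "q = group_exponent G"
  obtain act bd where "exterior_pairing G (ext_square G) (wedge G) act bd"
    using exists_exterior_pairing by blast
  then interpret exterior_pairing G "ext_square G" "wedge G" act bd .
  have nil: "lcs G c = {\<one>\<^bsub>G\<^esub>}" using assms(5) by (simp add: nilpotency_class_def)
  have p2: "2 \<le> p" using prime_ge_2_nat[OF assms(2)] .
  \<comment> \<open>Oddness enters here: it makes the base \<open>p - 1\<close> of the logarithm
    exceed 1.\<close>
  then have p3: "3 \<le> p" using assms(3) by (cases "p = 2") auto
  obtain e where "q = p ^ e"
    using group_exponent_p_group[OF assms(2,4)] by (auto simp: q_def)
  then have dv: "\<And>i. \<lbrakk>0 < i; i < p\<rbrakk> \<Longrightarrow> q dvd (q choose i)"
    using prime_power_dvd_choose[OF assms(2)] by simp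
  have exp: "t [^]\<^bsub>ext_square G\<^esub> (q ^ n) = \<one>\<^bsub>ext_square G\<^esub>" if "t \<in> carrier (ext_square G)" for t
  proof -
    have "t [^]\<^bsub>ext_square G\<^esub> (q ^ n) \<in> V (p ^ n - 1)"
      by (rule pow_exponent_power_V[OF nil p2 dv _ that]) (auto simp: q_def pow_group_exponent)
    also have "\<dots> \<subseteq> V c"
      using class_le_prime_power[OF p3 assms(6)] by (intro V_antimono) (simp add: n_def)
    finally show ?thesis using V_trivial[OF nil] by simp
  qed
  have "group_exponent (ext_square G) dvd q ^ n"
    by (rule group_exponent_dvdI) (rule exp)
  moreover have "group_exponent (schur_mult G) dvd q ^ n"
  proof (rule group_exponent_dvdI)
    fix x assume x: "x \<in> carrier (schur_mult G)"
    \<comment> \<open>The two structures differ only in their carriers, so powers agree.\<close>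
    have "x [^]\<^bsub>schur_mult G\<^esub> k = x [^]\<^bsub>ext_square G\<^esub> k" for k :: nat
      by (simp add: schur_mult_def nat_pow_def)
    then show "x [^]\<^bsub>schur_mult G\<^esub> q ^ n = \<one>\<^bsub>schur_mult G\<^esub>"
      using exp[of x] x by (simp add: schur_mult_def)
  qed
  ultimately show ?thesis by (simp add: n_def q_def)
qed

end
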